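(* Let $S\subseteq\mathbb{R}^n$ be a set and $V\subseteq\mathbb{R}[X_1,\ldots,X_n]$ a finite dimensional linear subspace containing $1$. Assume that the subset $P\subseteq V$ of all elements of $V$ that are nonnegative on $S$ is the projection of a spectrahedron. Then for any map $f=(f_1,\ldots,f_m)\colon\mathbb{R}^n\to\mathbb{R}^m$ with $f_i\in V$ for all $i$, the set $\overline{\operatorname{conv}(f(S))}\subseteq\mathbb{R}^m$ is the projection of a spectrahedron.
   Context: A spectrahedron in $\mathbb{R}^N$ is a set of the form $\{z\in\mathbb{R}^N\mid A_0+z_1A_1+\cdots+z_NA_N\succeq 0\}$ with $A_0,\ldots,A_N$ real symmetric matrices of the same size, where $\succeq 0$ means positive semidefinite. A set $T\subseteq\mathbb{R}^N$ is the projection of a spectrahedron if there are $M\ge 0$ and a spectrahedron $\widetilde T\subseteq\mathbb{R}^{N+M}$ with $T=\{x\in\mathbb{R}^N\mid \exists y\in\mathbb{R}^M:\ (x,y)\in\widetilde T\}$. For subsets of a finite dimensional real vector space, this notion is understood after identifying the space with $\mathbb{R}^N$ via a basis (it does not depend on the choice). *)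

theory Defs
  imports "HOL-Analysis.Analysis" "HOL-Library.Poly_Mapping"
begin

section \<open>Polynomials in finitely many variables\<close>

text \<open>A monomial is its exponent vector and a polynomial maps monomials to coefficients.
  Addition, multiplication and \<open>1\<close> are those of the type of finitely supported functions.\<close>

type_synonym 'n real_mpoly = "('n \<Rightarrow>\<^sub>0 nat) \<Rightarrow>\<^sub>0 real"

instantiation poly_mapping :: (type, real_vector) real_vector
begin

lift_definition scaleR_poly_mapping :: "real \<Rightarrow> ('a \<Rightarrow>\<^sub>0 'b) \<Rightarrow> 'a \<Rightarrow>\<^sub>0 'b"
  is "\<lambda>c p k. c *\<^sub>R p k"
  by (erule rev_finite_subset) auto

instance
  by standard (transfer; simp add: fun_eq_iff scaleR_add_right scaleR_add_left)+

end

definition mpoly_eval :: "'n::finite real_mpoly \<Rightarrow> real ^ 'n \<Rightarrow> real" where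
  "mpoly_eval p x =
     (\<Sum>a\<in>Poly_Mapping.keys p.
        Poly_Mapping.lookup p a * (\<Prod>i\<in>UNIV. (x $ i) ^ Poly_Mapping.lookup a i))"

section \<open>Spectrahedra and their projections\<close>

text \<open>A real \<open>d \<times> d\<close> matrix is a function on pairs of indices, of which only those below \<open>d\<close>
  matter; the size \<open>d\<close> is thus a number and can be quantified over.\<close>

definition symmetric_matrix :: "nat \<Rightarrow> (nat \<Rightarrow> nat \<Rightarrow> real) \<Rightarrow> bool" where
  "symmetric_matrix d A \<longleftrightarrow> (\<forall>r<d. \<forall>c<d. A r c = A c r)"

definition psd_matrix :: "nat \<Rightarrow> (nat \<Rightarrow> nat \<Rightarrow> real) \<Rightarrow> bool" where
  "psd_matrix d A \<longleftrightarrow>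
     symmetric_matrix d A \<and> (\<forall>v :: nat \<Rightarrow> real. (\<Sum>r<d. \<Sum>c<d. v r * A r c * v c) \<ge> 0)"

text \<open>Coordinates are indexed by an arbitrary finite set \<open>I\<close>, so that \<open>I \<rightarrow>\<^sub>E UNIV\<close>
  plays the role of \<open>\<real>\<^sup>N\<close> with \<open>N = card I\<close>.\<close>

definition spectrahedron :: "'i set \<Rightarrow> ('i \<Rightarrow> real) set \<Rightarrow> bool" where
  "spectrahedron I T \<longleftrightarrow> finite I \<and>
     (\<exists>d A\<^sub>0 A. symmetric_matrix d A\<^sub>0 \<and> (\<forall>i\<in>I. symmetric_matrix d (A i)) \<and>
        T = {z \<in> I \<rightarrow>\<^sub>E UNIV. psd_matrix d (\<lambda>r c. A\<^sub>0 r c + (\<Sum>i\<in>I. z i * A i r c))})"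

text \<open>The set \<open>I <+> {..<M}\<close> indexes the coordinates of \<open>\<real>\<^sup>N\<^sup>+\<^sup>M\<close>, and \<open>case_sum x y\<close> is the
  point \<open>(x, y)\<close>.\<close>

definition projected_spectrahedron :: "'i set \<Rightarrow> ('i \<Rightarrow> real) set \<Rightarrow> bool" where
  "projected_spectrahedron I T \<longleftrightarrow>
     (\<exists>(M::nat) T'. spectrahedron (I <+> {..<M}) T' \<and>
        T = {x \<in> I \<rightarrow>\<^sub>E UNIV. \<exists>y \<in> {..<M} \<rightarrow>\<^sub>E UNIV. case_sum x y \<in> T'})"

text \<open>Subsets of a finite dimensional subspace \<open>V\<close> are read in coordinates with respect to a
  basis \<open>B\<close> of \<open>V\<close>; the coordinates are indexed by the basis vectors themselves.\<close>

definition projected_spectrahedron_in :: "'v::real_vector set \<Rightarrow> 'v set \<Rightarrow> bool" where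
  "projected_spectrahedron_in V T \<longleftrightarrow> T \<subseteq> V \<and>
     (\<exists>B. finite B \<and> independent B \<and> span B = V \<and>
        projected_spectrahedron B {z \<in> B \<rightarrow>\<^sub>E UNIV. (\<Sum>b\<in>B. z b *\<^sub>R b) \<in> T})"

text \<open>In \<open>\<real>\<^sup>m\<close> the standard coordinates are used.\<close>

definition projected_spectrahedron_vec :: "(real ^ 'm::finite) set \<Rightarrow> bool" where
  "projected_spectrahedron_vec T \<longleftrightarrow> projected_spectrahedron UNIV (($) ` T)"

end

theory Submission
  imports Defs "HOL-Library.Function_Algebras"
begin

text \<open>By separation, a point lies in the closed convex hull of \<open>f(S)\<close> iff every affine functional
  whose pullback along \<open>f\<close> lies in \<open>P\<close> is nonnegative at it. So it suffices to describe the affine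
  functionals that are nonnegative on a nonempty spectrahedron by a linear matrix inequality with
  additional variables. This is semidefinite duality, except that strict feasibility may fail.
  The remedy: among the matrices \<open>L(z) \<succeq> 0\<close> of the spectrahedron choose finitely many that span the
  others, and let \<open>M\<close> be their sum; every \<open>L(z)\<close> is then dominated by a multiple of \<open>M\<close>. A functional
  is nonnegative iff it is given, up to a nonnegative constant, by \<open>\<langle>W, L(z)\<rangle>\<close> for some \<open>W\<close> that is
  nonnegative on the vectors \<open>v\<close> with \<open>v v\<^sup>T \<preceq> s M\<close> for some \<open>s\<close>. These vectors form a fixed subspace,
  so the condition on \<open>W\<close> is again a linear matrix inequality. The multiplier \<open>W\<close> comes from the
  M. Riesz extension theorem, for which domination by \<open>M\<close> is exactly the hypothesis needed.\<close>

section \<open>Positive extension of linear functionals\<close>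

text \<open>Vectors and matrices are encoded as functions, so this instance is what lets
  \<open>span\<close>, \<open>subspace\<close> and \<open>linear\<close> speak about them.\<close>

instantiation "fun" :: (type, real_vector) real_vector
begin

definition "r *\<^sub>R f = (\<lambda>x. r *\<^sub>R f x)"

instance
  by standard (simp_all add: scaleR_fun_def fun_eq_iff algebra_simps)

end

lemma scaleR_fun_apply [simp]: "(r *\<^sub>R f) x = r *\<^sub>R f x"
  by (simp add: scaleR_fun_def)

lemma sum_fun_apply [simp]: "(\<Sum>i\<in>A. f i) x = (\<Sum>i\<in>A. f i x)"
  by (induction A rule: infinite_finite_induct) simp_all

text \<open>Serves to choose finitely many generators from \<open>S\<close> itself, so that they
  inherit its properties. A maximal independent subset works, being no larger than
  \<open>T\<close>.\<close>

lemma finite_spanning_subset: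
  fixes S T :: "'a::real_vector set"
  assumes "finite T" and "S \<subseteq> span T"
  obtains B where "finite B" and "B \<subseteq> S" and "S \<subseteq> span B"
proof -
  obtain B where B: "B \<subseteq> S" "independent B" "S \<subseteq> span B"
    using maximal_independent_subset by blast
  then have "finite B"
    using independent_span_bound[OF assms(1), of B] assms(2) by blast
  with B that show ?thesis by blast
qed

text \<open>A linear functional on a subspace is handled as its graph, a subspace of the product with
  the reals.\<close>

lemma riesz_extension_step:
  fixes K :: "'a::real_vector set"
  assumes K: "convex_cone K"
    and H: "subspace H" and pos: "\<And>x r. (x, r) \<in> H \<Longrightarrow> x \<in> K \<Longrightarrow> 0 \<le> r"
    and e: "e \<in> K" "(f, s) \<in> H" "f - e \<in> K"
  obtains v :: real where "\<And>x r. (x, r) \<in> span (insert (e, v) H) \<Longrightarrow> x \<in> K \<Longrightarrow> 0 \<le> r"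
proof -
  have Kadd: "x + y \<in> K" if "x \<in> K" "y \<in> K" for x y
    using K that by (simp add: convex_cone_add)
  have Kscale: "c *\<^sub>R x \<in> K" if "x \<in> K" "0 \<le> c" for x c
    using K that by (simp add: convex_cone_scaleR)
  \<comment> \<open>Positivity forces the value at \<open>e\<close> to be at most every number in
    \<open>U\<close>, and at least \<open>q\<close> whenever \<open>(y, q)\<close> lies in
    \<open>H\<close> with \<open>e - y\<close> in \<open>K\<close>. The infimum of \<open>U\<close>
    meets both demands.\<close>
  define U where "U = {r. \<exists>x. (x, r) \<in> H \<and> x - e \<in> K}"
  have ne: "s \<in> U" using e unfolding U_def by blast
  have lower: "q \<le> r" if q: "(y, q) \<in> H" "e - y \<in> K" and r: "r \<in> U" for y q r
  proof -
    obtain x where x: "(x, r) \<in> H" "x - e \<in> K" using r U_def by blast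
    have "(x - y, r - q) \<in> H" using subspace_diff[OF H x(1) q(1)] by simp
    moreover have "x - y \<in> K" using Kadd[OF x(2) q(2)] by simp
    ultimately show ?thesis using pos by fastforce
  qed
  have "(0, 0) \<in> H" using subspace_0[OF H] by (simp add: zero_prod_def)
  then have bdd: "bdd_below U" using lower[of 0 0] e(1) by (intro bdd_belowI[of _ 0]) simp
  define v where "v = Inf U"
  have "0 \<le> r" if xr: "(x, r) \<in> span (insert (e, v) H)" and x: "x \<in> K" for x r
  proof -
    obtain t where "(x, r) - t *\<^sub>R (e, v) \<in> span H"
      using xr by (auto simp: span_insert)
    then have h: "(x - t *\<^sub>R e, r - t * v) \<in> H"
      using H by (simp add: span_eq_iff[THEN iffD2])
    \<comment> \<open>Dividing \<open>x - t e\<close> by \<open>-t\<close> gives an element of the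
      domain of \<open>H\<close> that lies below \<open>e\<close> if \<open>t > 0\<close> and above
      \<open>e\<close> if \<open>t < 0\<close>, in the order of \<open>K\<close>; accordingly its
      value is a lower bound or a member of \<open>U\<close>.\<close>
    consider "t = 0" | "t > 0" | "t < 0" by linarith
    then show ?thesis
    proof cases
      case 1 then show ?thesis using h x pos by simp
    next
      case 2
      have "((-1/t) *\<^sub>R (x - t *\<^sub>R e), (-1/t) * (r - t * v)) \<in> H"
        using subspace_scale[OF H h, of "-1/t"] by simp
      moreover have "e - (-1/t) *\<^sub>R (x - t *\<^sub>R e) = (1/t) *\<^sub>R x"
        using 2 by (simp add: algebra_simps)
      ultimately have "(-1/t) * (r - t * v) \<le> u" if "u \<in> U" for u
        using lower that Kscale[OF x, of "1/t"] 2 by fastforce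
      then have "(-1/t) * (r - t * v) \<le> v"
        unfolding v_def using ne by (intro cInf_greatest) auto
      then show ?thesis using 2 by (simp add: field_simps)
    next
      case 3
      have "((-1/t) *\<^sub>R (x - t *\<^sub>R e), (-1/t) * (r - t * v)) \<in> H"
        using subspace_scale[OF H h, of "-1/t"] by simp
      moreover have "(-1/t) *\<^sub>R (x - t *\<^sub>R e) - e = (-1/t) *\<^sub>R x"
        using 3 by (simp add: algebra_simps)
      moreover have "(-1/t) *\<^sub>R x \<in> K" using Kscale[OF x, of "-1/t"] 3 by simp
      ultimately have "(-1/t) * (r - t * v) \<in> U" unfolding U_def by auto
      then have "v \<le> (-1/t) * (r - t * v)"
        unfolding v_def using bdd by (rule cInf_lower)
      then show ?thesis using 3 by (simp add: field_simps)
    qed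
  qed
  with that show ?thesis by blast
qed

text \<open>The domination hypothesis mentions only the original \<open>H\<close>, so it survives
  each one-dimensional extension, and one step per element of \<open>D\<close> suffices.\<close>

lemma riesz_extension_graph:
  fixes K :: "'a::real_vector set"
  assumes K: "convex_cone K" and H: "subspace H"
    and pos: "\<And>x r. (x, r) \<in> H \<Longrightarrow> x \<in> K \<Longrightarrow> 0 \<le> (r::real)"
    and "finite D" and "D \<subseteq> K"
    and "\<And>e. e \<in> D \<Longrightarrow> \<exists>(f, s)\<in>H. f - e \<in> K"
  shows "\<exists>H'. subspace H' \<and> H \<subseteq> H' \<and> D \<subseteq> fst ` H' \<and> (\<forall>(x, r)\<in>H'. x \<in> K \<longrightarrow> 0 \<le> r)"
  using assms(4-)
proof (induction D rule: finite_induct)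
  case empty
  then show ?case using H pos by auto
next
  case (insert e D)
  obtain H' where H': "subspace H'" "H \<subseteq> H'" "D \<subseteq> fst ` H'"
    and pos': "\<forall>(x, r)\<in>H'. x \<in> K \<longrightarrow> 0 \<le> r"
    using insert by auto
  obtain f s where fs: "(f, s) \<in> H'" "f - e \<in> K" and e: "e \<in> K"
    using insert.prems H'(2) by blast
  obtain v where v: "\<And>x r. (x, r) \<in> span (insert (e, v) H') \<Longrightarrow> x \<in> K \<Longrightarrow> 0 \<le> r"
    using riesz_extension_step[OF K H'(1) _ e fs] pos' by blast
  have sup: "insert (e, v) H' \<subseteq> span (insert (e, v) H')" by (rule span_superset)
  show ?case
  proof (intro exI conjI)
    show "subspace (span (insert (e, v) H'))" by simp
    show "H \<subseteq> span (insert (e, v) H')" using sup H'(2) by blast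
    show "insert e D \<subseteq> fst ` span (insert (e, v) H')"
      using sup H'(3) by force
    show "\<forall>(x, r)\<in>span (insert (e, v) H'). x \<in> K \<longrightarrow> 0 \<le> r" using v by blast
  qed
qed

theorem riesz_extension:
  fixes K :: "'a::real_vector set"
  assumes K: "convex_cone K" and H: "subspace H"
    and pos: "\<And>x r. (x, r) \<in> H \<Longrightarrow> x \<in> K \<Longrightarrow> 0 \<le> (r::real)"
    and "finite D" and "D \<subseteq> K"
    and "\<And>e. e \<in> D \<Longrightarrow> \<exists>(f, s)\<in>H. f - e \<in> K"
  shows "\<exists>g. linear g \<and> (\<forall>(x, r)\<in>H. g x = r) \<and> (\<forall>x\<in>K \<inter> span D. 0 \<le> g x)"
proof -
  have "\<exists>H'. subspace H' \<and> H \<subseteq> H' \<and> D \<subseteq> fst ` H' \<and> (\<forall>(x, r)\<in>H'. x \<in> K \<longrightarrow> 0 \<le> r)"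
    by (rule riesz_extension_graph[OF K H _ assms(4-6)]) (rule pos)
  then obtain H' where H': "subspace H'" "H \<subseteq> H'" "D \<subseteq> fst ` H'"
    and pos': "\<And>x r. (x, r) \<in> H' \<Longrightarrow> x \<in> K \<Longrightarrow> 0 \<le> r"
    by blast
  have K0: "0 \<in> K"
    using K by (rule convex_cone_contains_0)
  \<comment> \<open>Positivity alone makes \<open>H'\<close> a graph: the difference of two values
    at the same \<open>x\<close> is a value at \<open>0\<close>, which lies in \<open>K\<close>, and
    so is its negative.\<close>
  have unique: "r = q" if "(x, r) \<in> H'" "(x, q) \<in> H'" for x r q
  proof -
    have "(0, r - q) \<in> H'" "(0, q - r) \<in> H'"
      using subspace_diff[OF H'(1) that] subspace_diff[OF H'(1) that(2,1)] by simp_all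
    from this[THEN pos'[OF _ K0]] have "0 \<le> r - q" "0 \<le> q - r" .
    then show ?thesis by simp
  qed
  have subF: "subspace (fst ` H')"
    using H'(1) by (intro linear_subspace_image linear_fst)
  obtain B where B: "B \<subseteq> fst ` H'" "independent B" "fst ` H' \<subseteq> span B"
    by (rule maximal_independent_subset)
  obtain g where g: "linear g" "\<forall>b\<in>B. g b = (SOME r. (b, r) \<in> H')"
    using linear_independent_extend[OF B(2), of "\<lambda>b. SOME r. (b, r) \<in> H'"] by auto
  \<comment> \<open>Agreement of \<open>g\<close> with \<open>H'\<close> is a subspace condition,
    hence it needs checking only on the basis \<open>B\<close>.\<close>
  have "subspace {x. (x, g x) \<in> H'}"
  proof -
    have "linear (\<lambda>x. (x, g x))"
      using g(1) by (auto intro!: linearI simp: linear_add linear_scale)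
    from linear_subspace_vimage[OF this H'(1)] show ?thesis by (simp add: vimage_def)
  qed
  moreover have "(b, g b) \<in> H'" if "b \<in> B" for b
  proof -
    have "\<exists>r. (b, r) \<in> H'" using B(1) that by force
    then have "(b, SOME r. (b, r) \<in> H') \<in> H'" by (rule someI_ex)
    then show ?thesis using g(2) that by simp
  qed
  ultimately have "span B \<subseteq> {x. (x, g x) \<in> H'}" by (intro span_minimal) auto
  then have graph: "(x, g x) \<in> H'" if "x \<in> fst ` H'" for x using B(3) that by blast
  have "g x = r" if "(x, r) \<in> H" for x r
  proof -
    have xr: "(x, r) \<in> H'" using H'(2) that by blast
    then have "x \<in> fst ` H'" by force
    from unique[OF graph[OF this] xr] show ?thesis .
  qed
  moreover have "0 \<le> g x" if "x \<in> K" "x \<in> span D" for x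
  proof -
    have "x \<in> fst ` H'" using span_minimal[OF H'(3) subF] that(2) by blast
    from pos'[OF graph[OF this] that(1)] show ?thesis .
  qed
  ultimately show ?thesis using g(1) by (intro exI[of _ g]) auto
qed

section \<open>Positive semidefinite matrices\<close>

definition matrix_form :: "nat \<Rightarrow> (nat \<Rightarrow> nat \<Rightarrow> real) \<Rightarrow> (nat \<Rightarrow> real) \<Rightarrow> (nat \<Rightarrow> real) \<Rightarrow> real" where
  "matrix_form d A u w = (\<Sum>r<d. \<Sum>c<d. u r * A r c * w c)"

definition trace_inner :: "nat \<Rightarrow> (nat \<Rightarrow> nat \<Rightarrow> real) \<Rightarrow> (nat \<Rightarrow> nat \<Rightarrow> real) \<Rightarrow> real" where
  "trace_inner d A X = (\<Sum>r<d. \<Sum>c<d. A r c * X r c)"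

definition outer :: "(nat \<Rightarrow> real) \<Rightarrow> nat \<Rightarrow> nat \<Rightarrow> real" where
  "outer v = (\<lambda>r c. v r * v c)"

definition unit_vec :: "nat \<Rightarrow> nat \<Rightarrow> real" where
  "unit_vec i = (\<lambda>r. of_bool (r = i))"

lemma psd_matrix_iff:
  "psd_matrix d A \<longleftrightarrow> symmetric_matrix d A \<and> (\<forall>v. 0 \<le> matrix_form d A v v)"
  by (simp add: psd_matrix_def matrix_form_def)

lemma linear_matrix_form_left: "linear (\<lambda>u. matrix_form d A u w)"
  by (rule linearI)
     (simp_all add: matrix_form_def sum.distrib sum_distrib_left algebra_simps)

lemma linear_matrix_form_right: "linear (\<lambda>w. matrix_form d A u w)"
  by (rule linearI)
     (simp_all add: matrix_form_def sum.distrib sum_distrib_left algebra_simps)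

lemma linear_matrix_form: "linear (\<lambda>A. matrix_form d A u w)"
  by (rule linearI)
     (simp_all add: matrix_form_def sum.distrib sum_distrib_left algebra_simps)

lemma linear_trace_inner: "linear (\<lambda>X. trace_inner d A X)"
  by (rule linearI)
     (simp_all add: trace_inner_def sum.distrib sum_distrib_left algebra_simps)

lemmas matrix_form_linear_simps =
  linear_add[OF linear_matrix_form_left] linear_add[OF linear_matrix_form_right]
  linear_scale[OF linear_matrix_form_left] linear_scale[OF linear_matrix_form_right]
  linear_add[OF linear_matrix_form] linear_scale[OF linear_matrix_form]
  linear_diff[OF linear_matrix_form]

lemma matrix_form_outer:
  "matrix_form d (outer v) u w = (\<Sum>r<d. u r * v r) * (\<Sum>r<d. w r * v r)"
  by (simp add: matrix_form_def outer_def sum_product algebra_simps)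

lemma trace_inner_outer: "trace_inner d A (outer v) = matrix_form d A v v"
  by (simp add: matrix_form_def trace_inner_def outer_def algebra_simps)

lemma matrix_form_unit_vec_right:
  "i < d \<Longrightarrow> matrix_form d A u (unit_vec i) = (\<Sum>r<d. u r * A r i)"
  by (simp add: matrix_form_def unit_vec_def)

lemma matrix_form_commute:
  assumes "symmetric_matrix d A"
  shows "matrix_form d A u w = matrix_form d A w u"
proof -
  have "matrix_form d A u w = (\<Sum>c<d. \<Sum>r<d. u r * A r c * w c)"
    unfolding matrix_form_def by (rule sum.swap)
  also have "\<dots> = matrix_form d A w u"
    using assms unfolding matrix_form_def symmetric_matrix_def
    by (intro sum.cong refl) (simp add: algebra_simps)
  finally show ?thesis .
qed

lemma matrix_form_diagonal:
  "i < d \<Longrightarrow> matrix_form d A (unit_vec i) (unit_vec i) = A i i"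
  by (simp add: matrix_form_unit_vec_right) (simp add: unit_vec_def)

lemma symmetric_matrix_outer [simp]: "symmetric_matrix d (outer v)"
  by (simp add: symmetric_matrix_def outer_def)

lemma psd_matrix_outer [simp]: "psd_matrix d (outer v)"
  by (simp add: psd_matrix_iff matrix_form_outer)

lemma psd_matrix_0 [simp]: "psd_matrix d 0"
  by (simp add: psd_matrix_def symmetric_matrix_def)

lemma symmetric_matrix_add:
  "symmetric_matrix d A \<Longrightarrow> symmetric_matrix d B \<Longrightarrow> symmetric_matrix d (A + B)"
  by (simp add: symmetric_matrix_def)

lemma symmetric_matrix_diff:
  "symmetric_matrix d A \<Longrightarrow> symmetric_matrix d B \<Longrightarrow> symmetric_matrix d (A - B)"
  by (simp add: symmetric_matrix_def)

lemma symmetric_matrix_scaleR: "symmetric_matrix d A \<Longrightarrow> symmetric_matrix d (c *\<^sub>R A)"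
  by (simp add: symmetric_matrix_def)

lemma psd_matrix_add: "psd_matrix d A \<Longrightarrow> psd_matrix d B \<Longrightarrow> psd_matrix d (A + B)"
  by (simp add: psd_matrix_iff matrix_form_linear_simps symmetric_matrix_add)

lemma psd_matrix_scaleR: "psd_matrix d A \<Longrightarrow> 0 \<le> c \<Longrightarrow> psd_matrix d (c *\<^sub>R A)"
  by (simp add: psd_matrix_iff matrix_form_linear_simps symmetric_matrix_scaleR)

lemma psd_matrix_sum: "(\<And>i. i \<in> I \<Longrightarrow> psd_matrix d (A i)) \<Longrightarrow> psd_matrix d (\<Sum>i\<in>I. A i)"
  by (induction I rule: infinite_finite_induct) (simp_all add: psd_matrix_add)

lemma psd_matrix_diagonal_nonneg: "psd_matrix d A \<Longrightarrow> i < d \<Longrightarrow> 0 \<le> A i i"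
  by (metis matrix_form_diagonal psd_matrix_iff)

lemma psd_matrix_Cauchy_Schwarz:
  assumes A: "psd_matrix d A"
  shows "(matrix_form d A u w)\<^sup>2 \<le> matrix_form d A u u * matrix_form d A w w"
proof -
  let ?a = "matrix_form d A w w" and ?b = "matrix_form d A u w" and ?q = "matrix_form d A u u"
  have sym: "matrix_form d A w u = ?b"
    using A by (simp add: psd_matrix_iff matrix_form_commute)
  have expand: "matrix_form d A (u + t *\<^sub>R w) (u + t *\<^sub>R w) = ?q + 2 * t * ?b + t\<^sup>2 * ?a" for t
    by (simp add: matrix_form_linear_simps sym algebra_simps power2_eq_square)
  have nonneg: "0 \<le> ?q + 2 * t * ?b + t\<^sup>2 * ?a" for t
    using A by (simp flip: expand add: psd_matrix_iff)
  have a: "0 \<le> ?a" using A by (simp add: psd_matrix_iff)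
  show ?thesis
  proof (cases "?a = 0")
    case True
    \<comment> \<open>With \<open>?a = 0\<close> the form is affine in \<open>t\<close>; the value
      of \<open>t\<close> used below would make it equal to \<open>-1\<close>.\<close>
    have "?b = 0"
    proof (rule ccontr)
      assume "?b \<noteq> 0"
      then show False using nonneg[of "- (?q + 1) / (2 * ?b)"] True by (simp add: field_simps)
    qed
    then show ?thesis by (simp add: True)
  next
    case False
    then have "0 \<le> ?q - ?b\<^sup>2 / ?a"
      using nonneg[of "- ?b / ?a"] by (simp add: power2_eq_square)
    then show ?thesis using False a by (simp add: field_simps)
  qed
qed

text \<open>The induction subtracts rank one matrices, one nonzero diagonal entry at a time, so that no
  spectral theorem is needed.\<close>

lemma trace_inner_nonneg:
  assumes "psd_matrix d X"
    and "\<And>v. psd_matrix d (X - outer v) \<Longrightarrow> 0 \<le> matrix_form d A v v"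
  shows "0 \<le> trace_inner d A X"
  using assms
proof (induction "card {i. i < d \<and> X i i \<noteq> 0}" arbitrary: X rule: less_induct)
  case less
  note X = less.prems(1)
  have symX: "X r c = X c r" if "r < d" "c < d" for r c
    using X that by (simp add: psd_matrix_def symmetric_matrix_def)
  show ?case
  proof (cases "\<exists>i<d. X i i \<noteq> 0")
    case False
    \<comment> \<open>By Cauchy-Schwarz, a positive semidefinite matrix with zero diagonal vanishes;
      this is the base of the induction.\<close>
    have "X r c = 0" if rc: "r < d" "c < d" for r c
    proof -
      have "(matrix_form d X (unit_vec r) (unit_vec c))\<^sup>2 \<le> 0"
        using psd_matrix_Cauchy_Schwarz[OF X, of "unit_vec r" "unit_vec c"] rc False
        by (simp add: matrix_form_diagonal)
      moreover have "matrix_form d X (unit_vec r) (unit_vec c) = X r c"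
        using rc by (simp add: matrix_form_unit_vec_right) (simp add: unit_vec_def)
      ultimately show ?thesis by simp
    qed
    then show ?thesis by (simp add: trace_inner_def)
  next
    case True
    then obtain i where i: "i < d" "X i i \<noteq> 0" by blast
    then have Xii: "0 < X i i"
      using psd_matrix_diagonal_nonneg[OF X] by (simp add: order_less_le)
    \<comment> \<open>One Cholesky step: \<open>v\<close> is column \<open>i\<close>, scaled so that
      \<open>Y\<close> has a zero at position \<open>(i, i)\<close>. That \<open>Y\<close> stays
      positive semidefinite is the Cauchy-Schwarz inequality against
      \<open>unit_vec i\<close>.\<close>
    define v where "v = (\<lambda>r. X r i / sqrt (X i i))"
    define Y where "Y = X - outer v"
    have vv: "v r * v c = X r i * X c i / X i i" for r c
      using Xii by (simp add: v_def)
    have form_outer: "matrix_form d (outer v) u u = (matrix_form d X u (unit_vec i))\<^sup>2 / X i i" for u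
    proof -
      have "(\<Sum>r<d. u r * v r) = (\<Sum>r<d. u r * X r i) / sqrt (X i i)"
        by (simp add: v_def sum_divide_distrib)
      then show ?thesis
        using i Xii
        by (simp add: matrix_form_outer matrix_form_unit_vec_right power2_eq_square)
    qed
    have "0 \<le> matrix_form d Y u u" for u
      using psd_matrix_Cauchy_Schwarz[OF X, of u "unit_vec i"] i Xii
      by (simp add: Y_def matrix_form_linear_simps form_outer matrix_form_diagonal field_simps)
    then have Y: "psd_matrix d Y"
      using X by (simp add: psd_matrix_iff Y_def symmetric_matrix_diff)
    have X_eq: "X = Y + outer v" by (simp add: Y_def)
    have Yii: "Y i i = 0" using i by (simp add: Y_def outer_def vv)
    \<comment> \<open>No zero diagonal entry becomes nonzero, while entry \<open>i\<close> vanishes,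
      so the induction measure drops.\<close>
    have "Y j j = 0" if "j < d" "X j j = 0" for j
    proof -
      have "0 \<le> Y j j" using Y that(1) by (rule psd_matrix_diagonal_nonneg)
      moreover have "Y j j \<le> X j j" by (simp add: Y_def outer_def)
      ultimately show ?thesis using that(2) by simp
    qed
    then have "{j. j < d \<and> Y j j \<noteq> 0} \<subset> {j. j < d \<and> X j j \<noteq> 0}"
      using i Yii by blast
    then have card: "card {j. j < d \<and> Y j j \<noteq> 0} < card {j. j < d \<and> X j j \<noteq> 0}"
      by (simp add: psubset_card_mono)
    have "0 \<le> trace_inner d A Y"
    proof (rule less.hyps[OF card Y])
      \<comment> \<open>Whatever is dominated by \<open>Y\<close> is dominated by
        \<open>X = Y + outer v\<close>, so the hypothesis on \<open>A\<close> passes to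
        \<open>Y\<close>.\<close>
      fix w assume "psd_matrix d (Y - outer w)"
      then have "psd_matrix d (Y - outer w + outer v)" by (simp add: psd_matrix_add)
      then show "0 \<le> matrix_form d A w w"
        by (intro less.prems(2)) (simp add: X_eq algebra_simps)
    qed
    moreover have "0 \<le> matrix_form d A v v"
      using Y less.prems(2) by (simp add: Y_def)
    ultimately show ?thesis
      by (simp add: X_eq linear_add[OF linear_trace_inner] trace_inner_outer)
  qed
qed

section \<open>Duality for spectrahedra\<close>

text \<open>Entries beyond \<open>d\<close> are arbitrary in this encoding of matrices. Setting them
  to zero moves a matrix into a finite dimensional space, where finite spanning sets exist.\<close>

definition truncate :: "nat \<Rightarrow> (nat \<Rightarrow> nat \<Rightarrow> real) \<Rightarrow> nat \<Rightarrow> nat \<Rightarrow> real" where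
  "truncate d X = (\<lambda>r c. if r < d \<and> c < d then X r c else 0)"

definition unit_matrix :: "nat \<Rightarrow> nat \<Rightarrow> nat \<Rightarrow> nat \<Rightarrow> real" where
  "unit_matrix i j = (\<lambda>r c. of_bool (r = i \<and> c = j))"

lemma linear_truncate: "linear (truncate d)"
  by (rule linearI) (auto simp: truncate_def fun_eq_iff)

lemma psd_matrix_truncate [simp]: "psd_matrix d (truncate d X) \<longleftrightarrow> psd_matrix d X"
  by (simp add: psd_matrix_def symmetric_matrix_def truncate_def)

lemma psd_matrix_diff_truncate [simp]:
  "psd_matrix d (X - truncate d Y) \<longleftrightarrow> psd_matrix d (X - Y)"
  by (simp add: psd_matrix_def symmetric_matrix_def truncate_def)

lemma truncate_eq_sum:
  "truncate d X = (\<Sum>i<d. \<Sum>j<d. X i j *\<^sub>R unit_matrix i j)"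
proof (intro ext)
  fix r c
  have "(\<Sum>i<d. \<Sum>j<d. X i j * of_bool (r = i \<and> c = j))
      = (\<Sum>i<d. if r = i then (\<Sum>j<d. if c = j then X i j else 0) else 0)"
    by (intro sum.cong refl) (auto intro!: sum.cong)
  then show "truncate d X r c = (\<Sum>i<d. \<Sum>j<d. X i j *\<^sub>R unit_matrix i j) r c"
    by (simp add: truncate_def unit_matrix_def)
qed

lemma truncate_in_span:
  "truncate d X \<in> span ((\<lambda>(i, j). unit_matrix i j) ` ({..<d} \<times> {..<d}))"
  unfolding truncate_eq_sum
  by (intro span_sum span_scale span_base) auto

text \<open>A linear functional on d by d matrices is the pairing with the matrix of its values on
  matrix units. This converts the functional from \<open>riesz_extension\<close> into a
  multiplier.\<close>

lemma linear_on_truncate: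
  assumes "linear g"
  shows "g (truncate d X) = trace_inner d (\<lambda>r c. g (unit_matrix r c)) X"
  unfolding truncate_eq_sum trace_inner_def
  by (simp add: linear_sum[OF assms] linear_scale[OF assms] mult.commute)

text \<open>Taking \<open>s\<close> to be the sum of the absolute values of the coefficients of
  \<open>X\<close> leaves only nonnegative coefficients in the difference.\<close>

lemma dominated_by_sum:
  assumes "finite B" and "\<And>b. b \<in> B \<Longrightarrow> psd_matrix d b" and "X \<in> span B"
  obtains s where "0 \<le> s" and "psd_matrix d (s *\<^sub>R \<Sum>B - X)"
proof -
  obtain u where u: "X = (\<Sum>b\<in>B. u b *\<^sub>R b)"
    using assms(1,3) by (auto simp: span_finite)
  define s where "s = (\<Sum>b\<in>B. \<bar>u b\<bar>)"
  have le: "u b \<le> s" if "b \<in> B" for b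
    using member_le_sum[OF that, of "\<lambda>b. \<bar>u b\<bar>"] assms(1) unfolding s_def by auto
  have "s *\<^sub>R \<Sum>B - X = (\<Sum>b\<in>B. (s - u b) *\<^sub>R b)"
    by (simp add: u scaleR_sum_right scaleR_diff_left sum_subtractf)
  moreover have "psd_matrix d (\<Sum>b\<in>B. (s - u b) *\<^sub>R b)"
    using assms(2) le by (intro psd_matrix_sum psd_matrix_scaleR) auto
  moreover have "0 \<le> s" by (simp add: s_def sum_nonneg)
  ultimately show ?thesis using that by simp
qed

text \<open>For positive semidefinite \<open>X\<close> this is the column space of its d by d block.
  Closure under addition is the parallelogram identity: \<open>2 v v^T + 2 w w^T\<close> minus
  \<open>(v + w) (v + w)^T\<close> equals \<open>(v - w) (v - w)^T\<close>.\<close>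

lemma outer_dominated_subspace:
  "subspace {v. (\<forall>r\<ge>d. v r = 0) \<and> (\<exists>s\<ge>0. psd_matrix d (s *\<^sub>R X - outer v))}" (is "subspace ?R")
proof (rule subspaceI)
  have "outer 0 = 0" by (simp add: outer_def fun_eq_iff)
  then show "0 \<in> ?R" by (auto intro!: exI[of _ 0])
next
  fix v w assume "v \<in> ?R" "w \<in> ?R"
  then obtain s t where s: "0 \<le> s" "psd_matrix d (s *\<^sub>R X - outer v)"
    and t: "0 \<le> t" "psd_matrix d (t *\<^sub>R X - outer w)" by blast
  have "(2 * (s + t)) *\<^sub>R X - outer (v + w)
      = 2 *\<^sub>R (s *\<^sub>R X - outer v) + 2 *\<^sub>R (t *\<^sub>R X - outer w) + outer (v - w)"
    by (simp add: outer_def fun_eq_iff algebra_simps)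
  moreover have "psd_matrix d \<dots>"
    using s t by (intro psd_matrix_add psd_matrix_scaleR) auto
  ultimately have "psd_matrix d ((2 * (s + t)) *\<^sub>R X - outer (v + w))" by simp
  then show "v + w \<in> ?R"
    using \<open>v \<in> ?R\<close> \<open>w \<in> ?R\<close> s(1) t(1) by (auto intro!: exI[of _ "2 * (s + t)"])
next
  fix c v assume "v \<in> ?R"
  then obtain s where s: "0 \<le> s" "psd_matrix d (s *\<^sub>R X - outer v)" by blast
  have "(c\<^sup>2 * s) *\<^sub>R X - outer (c *\<^sub>R v) = c\<^sup>2 *\<^sub>R (s *\<^sub>R X - outer v)"
    by (simp add: outer_def fun_eq_iff algebra_simps power2_eq_square)
  moreover have "psd_matrix d \<dots>" using s by (intro psd_matrix_scaleR) auto
  ultimately show "c *\<^sub>R v \<in> ?R"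
    using \<open>v \<in> ?R\<close> s(1) by (auto intro!: exI[of _ "c\<^sup>2 * s"])
qed

lemma supported_in_span_unit_vec:
  assumes "\<And>r. d \<le> r \<Longrightarrow> v r = 0"
  shows "v \<in> span (unit_vec ` {..<d})"
proof -
  have "v r = (\<Sum>i<d. v i *\<^sub>R unit_vec i) r" for r
  proof -
    have "(\<Sum>i<d. v i * of_bool (r = i)) = (\<Sum>i<d. if r = i then v i else 0)"
      by (intro sum.cong) auto
    then show ?thesis using assms[of r] by (simp add: unit_vec_def)
  qed
  then have "v = (\<Sum>i<d. v i *\<^sub>R unit_vec i)" by (rule ext)
  also have "\<dots> \<in> span (unit_vec ` {..<d})"
    by (intro span_sum span_scale span_base) auto
  finally show ?thesis .
qed

text \<open>The extra coefficient \<open>t\<close> homogenises the affine pencil: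
  \<open>t = 1\<close> describes the spectrahedron, and the dependence on \<open>(t, z)\<close> is
  linear, as the extension argument needs.\<close>

definition pencil :: "(nat \<Rightarrow> nat \<Rightarrow> real) \<Rightarrow> ('i \<Rightarrow> nat \<Rightarrow> nat \<Rightarrow> real) \<Rightarrow> 'i set
    \<Rightarrow> real \<Rightarrow> ('i \<Rightarrow> real) \<Rightarrow> nat \<Rightarrow> nat \<Rightarrow> real" where
  "pencil A\<^sub>0 A I t z = t *\<^sub>R A\<^sub>0 + (\<Sum>i\<in>I. z i *\<^sub>R A i)"

lemma pencil_add: "pencil A\<^sub>0 A I (s + t) (y + z) = pencil A\<^sub>0 A I s y + pencil A\<^sub>0 A I t z"
  by (simp add: pencil_def algebra_simps sum.distrib)

lemma pencil_scaleR: "pencil A\<^sub>0 A I (s * t) (s *\<^sub>R z) = s *\<^sub>R pencil A\<^sub>0 A I t z"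
  by (simp add: pencil_def algebra_simps scaleR_sum_right)

lemma linear_pencil: "linear (\<lambda>(t, z). pencil A\<^sub>0 A I t z)"
  by (rule linearI) (auto simp: pencil_add pencil_scaleR)

text \<open>In the case \<open>t = 0\<close>, \<open>z\<close> is a recession direction and is tested along the ray from \<open>z\<^sub>0\<close>.\<close>

lemma pencil_homogenised_nonneg:
  assumes "psd_matrix d (pencil A\<^sub>0 A I 1 z\<^sub>0)"
    and nonneg: "\<And>z. psd_matrix d (pencil A\<^sub>0 A I 1 z) \<Longrightarrow> 0 \<le> c + (\<Sum>i\<in>I. l i * z i)"
    and t: "0 \<le> t" and psd: "psd_matrix d (pencil A\<^sub>0 A I t z)"
  shows "0 \<le> c * t + (\<Sum>i\<in>I. l i * z i)"
proof (cases "t = 0")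
  case True
  define p where "p = (\<Sum>i\<in>I. l i * z i)"
  define q where "q = c + (\<Sum>i\<in>I. l i * z\<^sub>0 i)"
  have ray: "0 \<le> q + s * p" if s: "0 \<le> s" for s
  proof -
    have "psd_matrix d (pencil A\<^sub>0 A I 1 z\<^sub>0 + s *\<^sub>R pencil A\<^sub>0 A I 0 z)"
      using assms(1) psd s True by (intro psd_matrix_add psd_matrix_scaleR) auto
    then have "psd_matrix d (pencil A\<^sub>0 A I 1 (z\<^sub>0 + s *\<^sub>R z))"
      using pencil_add[of A\<^sub>0 A I 1 0 z\<^sub>0 "s *\<^sub>R z"] pencil_scaleR[of A\<^sub>0 A I s 0 z] by simp
    from nonneg[OF this] show ?thesis
      by (simp add: p_def q_def sum.distrib sum_distrib_left algebra_simps)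
  qed
  have "0 \<le> p"
  proof (rule ccontr)
    assume "\<not> 0 \<le> p"
    moreover have "0 \<le> q" using ray[of 0] by simp
    \<comment> \<open>At this value of the parameter \<open>s\<close>, the number
      \<open>q + s * p\<close> equals \<open>-1\<close>.\<close>
    ultimately have "0 \<le> (q + 1) / (- p)" by (intro divide_nonneg_pos) auto
    from ray[OF this] show False using \<open>\<not> 0 \<le> p\<close> by (simp add: field_simps)
  qed
  then show ?thesis by (simp add: True p_def)
next
  case False
  with t have "0 < t" by simp
  have "psd_matrix d ((1/t) *\<^sub>R pencil A\<^sub>0 A I t z)"
    using psd \<open>0 < t\<close> by (intro psd_matrix_scaleR) auto
  then have "psd_matrix d (pencil A\<^sub>0 A I 1 ((1/t) *\<^sub>R z))"
    using pencil_scaleR[of A\<^sub>0 A I "1/t" t z] \<open>0 < t\<close> by simp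
  from nonneg[OF this] have "0 \<le> t * (c + (\<Sum>i\<in>I. l i * (z i / t)))"
    using \<open>0 < t\<close> by simp
  also have "\<dots> = c * t + (\<Sum>i\<in>I. l i * z i)"
    using \<open>0 < t\<close> by (simp add: distrib_left sum_distrib_left)
  finally show ?thesis .
qed

text \<open>The order of quantifiers is essential: \<open>B\<close> depends only on the
  spectrahedron and not on \<open>l\<close> and \<open>c\<close>, so the conditions on
  \<open>W\<close> remain linear when the functional varies.\<close>

theorem spectrahedron_dual:
  assumes "finite I" and z0: "psd_matrix d (pencil A\<^sub>0 A I 1 z\<^sub>0)"
  shows "\<exists>B. finite B \<and> (\<forall>l c.
    (\<forall>z. psd_matrix d (pencil A\<^sub>0 A I 1 z) \<longrightarrow> 0 \<le> c + (\<Sum>i\<in>I. l i * z i)) \<longleftrightarrow>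
    (\<exists>W. (\<forall>v\<in>span B. 0 \<le> matrix_form d W v v) \<and>
       (\<forall>i\<in>I. trace_inner d W (A i) = l i) \<and> trace_inner d W A\<^sub>0 \<le> c))"
proof -
  let ?L = "pencil A\<^sub>0 A I"
  define S where "S = {truncate d (?L 1 z) |z. psd_matrix d (?L 1 z)}"
  have "S \<subseteq> span ((\<lambda>(i, j). unit_matrix i j) ` ({..<d} \<times> {..<d}))"
    unfolding S_def by (auto simp: truncate_in_span)
  from finite_spanning_subset[OF _ this] obtain C'
    where C': "finite C'" "C' \<subseteq> S" "S \<subseteq> span C'" by auto
  \<comment> \<open>The base point keeps \<open>C\<close> nonempty, so that \<open>k\<close> is at
    least 1; this lets \<open>(k, M)\<close> dominate \<open>(1, 0)\<close> later.\<close>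
  define C where "C = insert (truncate d (?L 1 z\<^sub>0)) C'"
  have C: "finite C" "C \<noteq> {}" "C \<subseteq> S" "S \<subseteq> span C"
    using C' z0 span_mono[of C' C] unfolding C_def S_def by auto
  have C_psd: "psd_matrix d X" if "X \<in> C" for X
    using C(3) that by (auto simp: S_def)
  have "\<forall>X\<in>C. \<exists>z. X = truncate d (?L 1 z)" using C(3) by (auto simp: S_def)
  then obtain \<zeta> where \<zeta>: "\<forall>X\<in>C. X = truncate d (?L 1 (\<zeta> X))" by (rule bchoice[THEN exE])
  define M where "M = \<Sum>C"
  define k where "k = real (card C)"
  have k: "1 \<le> k"
    using C(1,2) card_gt_0_iff[of C] by (simp add: k_def)
  have M_psd: "psd_matrix d M" unfolding M_def by (rule psd_matrix_sum) (rule C_psd)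
  \<comment> \<open>By linearity \<open>M\<close> is itself a value of the truncated homogenised
    pencil, at \<open>t = k\<close>, so \<open>(k, M)\<close> will lie in the domain of the
    functional to be extended.\<close>
  have M_pencil: "M = truncate d (?L k (\<Sum>X\<in>C. \<zeta> X))"
  proof -
    have "M = (\<Sum>X\<in>C. truncate d (?L 1 (\<zeta> X)))"
      unfolding M_def by (rule sum.cong) (use \<zeta> in auto)
    also have "\<dots> = truncate d (\<Sum>X\<in>C. ?L 1 (\<zeta> X))"
      by (rule linear_sum[OF linear_truncate, symmetric])
    also have "(\<Sum>X\<in>C. ?L 1 (\<zeta> X)) = ?L k (\<Sum>X\<in>C. \<zeta> X)"
      using linear_sum[OF linear_pencil, of A\<^sub>0 A I "\<lambda>X. (1, \<zeta> X)" C]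
      by (simp add: k_def fst_sum snd_sum case_prod_unfold)
    finally show ?thesis .
  qed
  define R where "R = {v. (\<forall>r\<ge>d. v r = 0) \<and> (\<exists>s\<ge>0. psd_matrix d (s *\<^sub>R M - outer v))}"
  have subR: "subspace R" unfolding R_def by (rule outer_dominated_subspace)
  have "R \<subseteq> span (unit_vec ` {..<d})"
    unfolding R_def by (auto intro: supported_in_span_unit_vec)
  from finite_spanning_subset[OF _ this] obtain B
    where B: "finite B" "B \<subseteq> R" "R \<subseteq> span B" by auto
  have span_B: "span B = R" using B span_minimal[OF B(2) subR] by blast

  \<comment> \<open>If \<open>outer v\<close> is dominated by \<open>?L 1 z\<close>, it is dominated
    by a multiple of \<open>M\<close>, hence \<open>v\<close> lies in \<open>R\<close> after
    truncation. So \<open>trace_inner_nonneg\<close> asks for nonnegativity of \<open>W\<close> on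
    \<open>R\<close> only.\<close>
  have weak: "0 \<le> c + (\<Sum>i\<in>I. l i * z i)"
    if W: "\<forall>v\<in>span B. 0 \<le> matrix_form d W v v" "\<forall>i\<in>I. trace_inner d W (A i) = l i"
      "trace_inner d W A\<^sub>0 \<le> c" and z: "psd_matrix d (?L 1 z)" for W l c z
  proof -
    have "truncate d (?L 1 z) \<in> span C" using C(4) z by (auto simp: S_def)
    from dominated_by_sum[OF C(1) C_psd this] obtain s
      where s: "0 \<le> s" "psd_matrix d (s *\<^sub>R M - ?L 1 z)"
      unfolding M_def psd_matrix_diff_truncate .
    have "0 \<le> trace_inner d W (?L 1 z)"
    proof (rule trace_inner_nonneg[OF z])
      fix v assume "psd_matrix d (?L 1 z - outer v)"
      from psd_matrix_add[OF s(2) this] have v: "psd_matrix d (s *\<^sub>R M - outer v)" by simp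
      define w where "w = (\<lambda>r. if r < d then v r else 0)"
      have "outer w = truncate d (outer v)"
        by (auto simp: outer_def truncate_def w_def fun_eq_iff)
      then have "w \<in> R" using v s(1) by (auto simp: R_def w_def)
      then have "0 \<le> matrix_form d W w w" using W(1) span_B by blast
      then show "0 \<le> matrix_form d W v v" by (simp add: matrix_form_def w_def)
    qed
    also have "trace_inner d W (?L 1 z) = trace_inner d W A\<^sub>0 + (\<Sum>i\<in>I. l i * z i)"
      using W(2)
      by (simp add: pencil_def linear_add[OF linear_trace_inner] linear_sum[OF linear_trace_inner]
          linear_scale[OF linear_trace_inner] mult.commute)
    finally show ?thesis using W(3) by simp
  qed

  have strong: "\<exists>W. (\<forall>v\<in>span B. 0 \<le> matrix_form d W v v) \<and>
       (\<forall>i\<in>I. trace_inner d W (A i) = l i) \<and> trace_inner d W A\<^sub>0 \<le> c"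
    if nonneg: "\<And>z. psd_matrix d (?L 1 z) \<Longrightarrow> 0 \<le> c + (\<Sum>i\<in>I. l i * z i)" for l c
  proof -
    define K where "K = {(t::real, X). 0 \<le> t \<and> psd_matrix d X}"
    \<comment> \<open>The range of \<open>h\<close> is the graph of the functional on pairs of
      \<open>t\<close> and the pencil. That arguments with the same pair get the same value comes
      from positivity, inside \<open>riesz_extension\<close>.\<close>
    define h where "h = (\<lambda>(t, z). ((t, truncate d (?L t z)), c * t + (\<Sum>i\<in>I. l i * z i)))"
    define H where "H = range h"
    have "linear h"
      by (rule linearI)
         (auto simp: h_def pencil_add pencil_scaleR linear_add[OF linear_truncate]
           linear_scale[OF linear_truncate] sum.distrib sum_distrib_left algebra_simps)
    then have H: "subspace H"
      unfolding H_def by (intro linear_subspace_image subspace_UNIV)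
    have K: "convex_cone K"
      by (auto simp: convex_cone_iff K_def zero_prod_def psd_matrix_add psd_matrix_scaleR)
    have pos: "0 \<le> r" if "(x, r) \<in> H" "x \<in> K" for x r
      using that pencil_homogenised_nonneg[OF z0 nonneg] by (auto simp: H_def h_def K_def)
    have M_H: "\<exists>r. ((k, M), r) \<in> H"
      using rangeI[of h "(k, \<Sum>X\<in>C. \<zeta> X)"] by (auto simp: H_def h_def simp flip: M_pencil)
    have "outer ` R \<subseteq> span ((\<lambda>(i, j). unit_matrix i j) ` ({..<d} \<times> {..<d}))"
    proof
      fix X assume "X \<in> outer ` R"
      then have "X = truncate d X"
        by (auto simp: R_def outer_def truncate_def fun_eq_iff)
      then show "X \<in> span ((\<lambda>(i, j). unit_matrix i j) ` ({..<d} \<times> {..<d}))"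
        using truncate_in_span[of d X] by simp
    qed
    from finite_spanning_subset[OF _ this] obtain D'
      where D': "finite D'" "D' \<subseteq> outer ` R" "outer ` R \<subseteq> span D'" by auto
    \<comment> \<open>The rank one matrices from \<open>R\<close> yield the condition on
      \<open>W\<close>, and \<open>(1, 0)\<close> yields the inequality for
      \<open>A\<^sub>0\<close>. Both kinds are dominated by multiples of
      \<open>(k, M)\<close>.\<close>
    define D where "D = insert (1::real, 0) (Pair 0 ` D')"
    have "finite D" using D'(1) by (simp add: D_def)
    have "D \<subseteq> K" using D'(2) by (auto simp: D_def K_def)
    have dom: "\<exists>(f, r)\<in>H. f - e \<in> K" if "e \<in> D" for e
    proof (cases "e = (1, 0)")
      case True
      then have "(k, M) - e \<in> K" using k M_psd by (simp add: K_def)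
      then show ?thesis using M_H by auto
    next
      case False
      then obtain v where v: "v \<in> R" "e = (0, outer v)" using \<open>e \<in> D\<close> D'(2) by (auto simp: D_def)
      then obtain s where s: "0 \<le> s" "psd_matrix d (s *\<^sub>R M - outer v)" by (auto simp: R_def)
      obtain r where "((k, M), r) \<in> H" using M_H by blast
      from subspace_scale[OF H this, of s] have "(s *\<^sub>R (k, M), s * r) \<in> H" by simp
      moreover have "s *\<^sub>R (k, M) - e \<in> K" using v s k by (simp add: K_def)
      ultimately show ?thesis by blast
    qed
    have "\<exists>g. linear g \<and> (\<forall>(x, r)\<in>H. g x = r) \<and> (\<forall>x\<in>K \<inter> span D. 0 \<le> g x)"
    proof (rule riesz_extension[OF K H _ \<open>finite D\<close> \<open>D \<subseteq> K\<close>])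
      show "0 \<le> r" if "(x, r) \<in> H" "x \<in> K" for x r using that by (rule pos)
      show "\<exists>(f, s)\<in>H. f - e \<in> K" if "e \<in> D" for e using that by (rule dom)
    qed
    then obtain g where g: "linear g"
      and gH: "\<forall>(x, r)\<in>H. g x = r" and gK: "\<forall>x\<in>K \<inter> span D. 0 \<le> g x"
      by (elim exE conjE)
    have g_H: "g x = r" if "(x, r) \<in> H" for x r using gH that by auto
    have g_nonneg: "0 \<le> g x" if "x \<in> K" "x \<in> span D" for x using gK that by simp
    define W where "W = (\<lambda>r c. g (0, unit_matrix r c))"
    have linear_Pair: "linear (\<lambda>X :: nat \<Rightarrow> nat \<Rightarrow> real. (0::real, X))" by (rule linearI) simp_all
    have gW: "g (0, truncate d X) = trace_inner d W X" for X
      using linear_on_truncate[OF linear_compose[OF linear_Pair g], of d X]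
      by (simp add: W_def)
    have g_pencil: "g (t, truncate d (?L t z)) = c * t + (\<Sum>i\<in>I. l i * z i)" for t z
      using rangeI[of h "(t, z)"] by (intro g_H) (simp add: H_def h_def)
    show ?thesis
    proof (intro exI[of _ W] conjI ballI)
      fix v assume "v \<in> span B"
      then have v: "v \<in> R" using span_B by simp
      then have "outer v = truncate d (outer v)"
        by (auto simp: R_def outer_def truncate_def fun_eq_iff)
      then have eq: "matrix_form d W v v = g (0, outer v)"
        using gW[of "outer v"] by (simp add: trace_inner_outer)
      have "(0::real, outer v) \<in> Pair 0 ` span D'" using D'(3) v by blast
      also have "\<dots> = span (Pair 0 ` D')"
        by (rule linear_span_image[OF linear_Pair, symmetric])
      also have "\<dots> \<subseteq> span D" unfolding D_def by (intro span_mono) auto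
      finally show "0 \<le> matrix_form d W v v"
        unfolding eq by (intro g_nonneg) (simp_all add: K_def)
    next
      fix i assume i: "i \<in> I"
      \<comment> \<open>At \<open>t = 0\<close> the constant term drops out, and a coordinate vector
        isolates \<open>A i\<close> and \<open>l i\<close>.\<close>
      have "?L 0 (\<lambda>j. of_bool (j = i)) = A i"
      proof -
        have "(\<Sum>j\<in>I. of_bool (j = i) *\<^sub>R A j) = (\<Sum>j\<in>I. if j = i then A j else 0)"
          by (intro sum.cong) auto
        then show ?thesis using i \<open>finite I\<close> by (simp add: pencil_def)
      qed
      moreover have "(\<Sum>j\<in>I. l j * of_bool (j = i)) = l i"
      proof -
        have "(\<Sum>j\<in>I. l j * of_bool (j = i)) = (\<Sum>j\<in>I. if j = i then l j else 0)"
          by (intro sum.cong) auto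
        then show ?thesis using i \<open>finite I\<close> by simp
      qed
      ultimately show "trace_inner d W (A i) = l i"
        using g_pencil[of 0 "\<lambda>j. of_bool (j = i)"] gW by simp
    next
      \<comment> \<open>At \<open>t = 1\<close> and \<open>z = 0\<close> the functional has the
        value \<open>c\<close>; splitting off \<open>(1, 0)\<close>, where it is nonnegative, leaves
        the pairing of \<open>W\<close> with \<open>A\<^sub>0\<close>.\<close>
      have "g (1, truncate d A\<^sub>0) = c"
        using g_pencil[of 1 0] by (simp add: pencil_def)
      moreover have "g (1, truncate d A\<^sub>0) = g (1, 0) + g (0, truncate d A\<^sub>0)"
        by (simp flip: linear_add[OF g])
      moreover have "0 \<le> g (1, 0)"
        by (intro g_nonneg) (auto simp: K_def D_def intro: span_base)
      ultimately show "trace_inner d W A\<^sub>0 \<le> c" using gW by simp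
    qed
  qed

  show ?thesis
  proof (intro exI[of _ B] conjI iffI allI impI)
    show "finite B" by (rule B(1))
  next
    fix l c z
    assume "\<exists>W. (\<forall>v\<in>span B. 0 \<le> matrix_form d W v v) \<and>
       (\<forall>i\<in>I. trace_inner d W (A i) = l i) \<and> trace_inner d W A\<^sub>0 \<le> c"
      and z: "psd_matrix d (?L 1 z)"
    then show "0 \<le> c + (\<Sum>i\<in>I. l i * z i)" by (elim exE conjE) (rule weak[OF _ _ _ z])
  qed (intro strong, simp)
qed

section \<open>Linear matrix inequalities with auxiliary variables\<close>

text \<open>A quadratic form sees only the symmetric part of its matrix, so the constructions below
  may use coefficient matrices that are not symmetric.\<close>

lemma quadratic_form_symmetrise:
  fixes H :: "'k \<Rightarrow> 'k \<Rightarrow> real"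
  shows "(\<Sum>r\<in>K. \<Sum>c\<in>K. v r * ((H r c + H c r) / 2) * v c) = (\<Sum>r\<in>K. \<Sum>c\<in>K. v r * H r c * v c)"
proof -
  have "(\<Sum>r\<in>K. \<Sum>c\<in>K. v r * H c r * v c) = (\<Sum>c\<in>K. \<Sum>r\<in>K. v r * H c r * v c)"
    by (rule sum.swap)
  also have "\<dots> = (\<Sum>r\<in>K. \<Sum>c\<in>K. v r * H r c * v c)"
    by (simp add: mult.commute mult.left_commute)
  finally have swap: "(\<Sum>r\<in>K. \<Sum>c\<in>K. v r * H c r * v c) = (\<Sum>r\<in>K. \<Sum>c\<in>K. v r * H r c * v c)" .
  have "(\<Sum>r\<in>K. \<Sum>c\<in>K. v r * ((H r c + H c r) / 2) * v c)
      = ((\<Sum>r\<in>K. \<Sum>c\<in>K. v r * H r c * v c) + (\<Sum>r\<in>K. \<Sum>c\<in>K. v r * H c r * v c)) / 2"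
    by (simp add: sum.distrib sum_divide_distrib algebra_simps add_divide_distrib)
  then show ?thesis using swap by simp
qed

lemma psd_matrix_reindex_iff:
  assumes "bij_betw k {..<d} K"
  shows "psd_matrix d (\<lambda>r c. (H (k r) (k c) + H (k c) (k r)) / 2) \<longleftrightarrow>
    (\<forall>u. 0 \<le> (\<Sum>r\<in>K. \<Sum>c\<in>K. u r * H r c * u c))" (is "?psd \<longleftrightarrow> ?form")
proof -
  have reindex: "(\<Sum>r<d. \<Sum>c<d. u (k r) * ((H (k r) (k c) + H (k c) (k r)) / 2) * u (k c))
      = (\<Sum>r\<in>K. \<Sum>c\<in>K. u r * H r c * u c)" for u
  proof -
    have "(\<Sum>r<d. \<Sum>c<d. u (k r) * ((H (k r) (k c) + H (k c) (k r)) / 2) * u (k c))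
        = (\<Sum>r<d. \<Sum>c<d. u (k r) * H (k r) (k c) * u (k c))"
      by (rule quadratic_form_symmetrise)
    also have "\<dots> = (\<Sum>r<d. \<Sum>c\<in>K. u (k r) * H (k r) c * u c)"
      by (intro sum.cong refl sum.reindex_bij_betw[OF assms])
    also have "\<dots> = (\<Sum>r\<in>K. \<Sum>c\<in>K. u r * H r c * u c)"
      by (rule sum.reindex_bij_betw[OF assms, of "\<lambda>r. \<Sum>c\<in>K. u r * H r c * u c"])
    finally show ?thesis .
  qed
  show ?thesis
  proof
    assume ?psd
    then show ?form
      unfolding psd_matrix_def by (intro allI) (simp flip: reindex)
  next
    assume form: ?form
    have "0 \<le> (\<Sum>r<d. \<Sum>c<d. v r * ((H (k r) (k c) + H (k c) (k r)) / 2) * v c)" for v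
    proof -
      define u where "u = v \<circ> inv_into {..<d} k"
      have "u (k r) = v r" if "r < d" for r
        using bij_betw_inv_into_left[OF assms, of r] that by (simp add: u_def)
      then show ?thesis using form[rule_format, of u] by (simp flip: reindex)
    qed
    then show ?psd by (simp add: psd_matrix_def symmetric_matrix_def add.commute)
  qed
qed

text \<open>A flexible form of the definition: arbitrary finite index sets, coefficient matrices
  without symmetry, and \<open>y\<close> ranging over all functions. Enumerating \<open>J\<close>
  and \<open>K\<close> and symmetrising reduces it to the definition.\<close>

lemma projected_spectrahedron_LMI:
  fixes G\<^sub>0 :: "'k \<Rightarrow> 'k \<Rightarrow> real" and GI :: "'i \<Rightarrow> 'k \<Rightarrow> 'k \<Rightarrow> real" and GJ :: "'j \<Rightarrow> 'k \<Rightarrow> 'k \<Rightarrow> real"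
  assumes "finite I" and "finite J" and "finite K"
  shows "projected_spectrahedron I {x \<in> I \<rightarrow>\<^sub>E UNIV. \<exists>y. \<forall>u. 0 \<le> (\<Sum>r\<in>K. \<Sum>c\<in>K.
    u r * (G\<^sub>0 r c + (\<Sum>i\<in>I. x i * GI i r c) + (\<Sum>j\<in>J. y j * GJ j r c)) * u c)}"
proof -
  define d where "d = card K"
  define M where "M = card J"
  obtain k where k: "bij_betw k {..<d} K"
    using ex_bij_betw_nat_finite[OF assms(3)] by (auto simp: d_def atLeast0LessThan)
  obtain b where b: "bij_betw b {..<M} J"
    using ex_bij_betw_nat_finite[OF assms(2)] by (auto simp: M_def atLeast0LessThan)
  define sym :: "('k \<Rightarrow> 'k \<Rightarrow> real) \<Rightarrow> nat \<Rightarrow> nat \<Rightarrow> real"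
    where "sym = (\<lambda>G r c. (G (k r) (k c) + G (k c) (k r)) / 2)"
  have sym: "symmetric_matrix d (sym G)" for G
    by (simp add: symmetric_matrix_def sym_def add.commute)
  define A where "A = case_sum (\<lambda>i. sym (GI i)) (\<lambda>m. sym (GJ (b m)))"
  define T where "T = {z \<in> (I <+> {..<M}) \<rightarrow>\<^sub>E UNIV.
    psd_matrix d (\<lambda>r c. sym G\<^sub>0 r c + (\<Sum>t\<in>I <+> {..<M}. z t * A t r c))}"
  have T: "spectrahedron (I <+> {..<M}) T"
    unfolding spectrahedron_def T_def
    by (intro conjI exI[of _ d] exI[of _ "sym G\<^sub>0"] exI[of _ A])
       (auto simp: assms(1) sym A_def)
  have in_T: "case_sum x y \<in> T \<longleftrightarrow> (\<forall>u. 0 \<le> (\<Sum>r\<in>K. \<Sum>c\<in>K.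
      u r * (G\<^sub>0 r c + (\<Sum>i\<in>I. x i * GI i r c) + (\<Sum>m<M. y m * GJ (b m) r c)) * u c))"
    if x: "x \<in> I \<rightarrow>\<^sub>E UNIV" and y: "y \<in> {..<M} \<rightarrow>\<^sub>E UNIV" for x y
  proof -
    let ?H = "\<lambda>r c. G\<^sub>0 r c + (\<Sum>i\<in>I. x i * GI i r c) + (\<Sum>m<M. y m * GJ (b m) r c)"
    have "case_sum x y \<in> (I <+> {..<M}) \<rightarrow>\<^sub>E UNIV"
      using x y by (auto simp: PiE_iff extensional_def split: sum.split)
    moreover have "(\<lambda>r c. sym G\<^sub>0 r c + (\<Sum>t\<in>I <+> {..<M}. case_sum x y t * A t r c)) = sym ?H"
      by (intro ext)
         (simp add: sum.Plus assms(1) A_def sym_def sum.distrib sum_divide_distrib algebra_simps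
           add_divide_distrib)
    ultimately show ?thesis
      unfolding T_def mem_Collect_eq using psd_matrix_reindex_iff[OF k, of ?H]
      by (simp add: sym_def)
  qed
  have reindex: "(\<Sum>m<M. y (b m) * GJ (b m) r c) = (\<Sum>j\<in>J. y j * GJ j r c)" for y r c
    by (rule sum.reindex_bij_betw[OF b])
  have "(\<exists>y. \<forall>u. 0 \<le> (\<Sum>r\<in>K. \<Sum>c\<in>K.
      u r * (G\<^sub>0 r c + (\<Sum>i\<in>I. x i * GI i r c) + (\<Sum>j\<in>J. y j * GJ j r c)) * u c))
    \<longleftrightarrow> (\<exists>y\<in>{..<M} \<rightarrow>\<^sub>E UNIV. case_sum x y \<in> T)" (is "?L \<longleftrightarrow> ?R")
    if x: "x \<in> I \<rightarrow>\<^sub>E UNIV" for x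
  proof
    assume ?L
    then obtain y where y: "\<forall>u. 0 \<le> (\<Sum>r\<in>K. \<Sum>c\<in>K.
      u r * (G\<^sub>0 r c + (\<Sum>i\<in>I. x i * GI i r c) + (\<Sum>j\<in>J. y j * GJ j r c)) * u c)" by blast
    \<comment> \<open>Points of a spectrahedron are extensional functions, so the auxiliary point
      has to be made undefined outside the index set.\<close>
    have "case_sum x (restrict (y \<circ> b) {..<M}) \<in> T"
      by (subst in_T[OF x]) (use y in \<open>auto simp: reindex\<close>)
    then show ?R by (rule bexI[of _ "restrict (y \<circ> b) {..<M}"]) auto
  next
    assume ?R
    then obtain y where y: "y \<in> {..<M} \<rightarrow>\<^sub>E UNIV" "case_sum x y \<in> T" by blast
    define y' where "y' = y \<circ> inv_into {..<M} b"
    have "(\<Sum>j\<in>J. y' j * GJ j r c) = (\<Sum>m<M. y m * GJ (b m) r c)" for r c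
      unfolding reindex[symmetric] y'_def
      by (intro sum.cong refl) (simp add: bij_betw_inv_into_left[OF b])
    then show ?L using y(2) unfolding in_T[OF x y(1)] by (intro exI[of _ y']) simp
  qed
  then have "{x \<in> I \<rightarrow>\<^sub>E UNIV. \<exists>y. \<forall>u. 0 \<le> (\<Sum>r\<in>K. \<Sum>c\<in>K.
      u r * (G\<^sub>0 r c + (\<Sum>i\<in>I. x i * GI i r c) + (\<Sum>j\<in>J. y j * GJ j r c)) * u c)}
    = {x \<in> I \<rightarrow>\<^sub>E UNIV. \<exists>y\<in>{..<M} \<rightarrow>\<^sub>E UNIV. case_sum x y \<in> T}"
    by (intro Collect_cong conj_cong refl)
  then show ?thesis
    unfolding projected_spectrahedron_def using T by blast
qed

text \<open>Each scalar of \<open>a\<close> is a 1 by 1 block next to \<open>G\<close>, so that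
  scalar inequalities can be absorbed into one matrix inequality.\<close>

definition block_diagonal ::
    "('k \<Rightarrow> 'k \<Rightarrow> real) \<Rightarrow> ('q \<Rightarrow> real) \<Rightarrow> 'k + 'q \<Rightarrow> 'k + 'q \<Rightarrow> real" where
  "block_diagonal G a = case_sum (\<lambda>r. case_sum (G r) (\<lambda>_. 0))
     (\<lambda>p. case_sum (\<lambda>_. 0) (\<lambda>q. if p = q then a p else 0))"

lemma block_diagonal_form:
  assumes "finite K" and "finite Q"
  shows "(\<Sum>r\<in>K <+> Q. \<Sum>c\<in>K <+> Q. u r * block_diagonal G a r c * u c)
    = (\<Sum>r\<in>K. \<Sum>c\<in>K. u (Inl r) * G r c * u (Inl c)) + (\<Sum>q\<in>Q. a q * (u (Inr q))\<^sup>2)"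
proof -
  have "(\<Sum>q\<in>Q. u (Inr p) * (if p = q then a p else 0) * u (Inr q)) = a p * (u (Inr p))\<^sup>2"
    if "p \<in> Q" for p
  proof -
    have "(\<Sum>q\<in>Q. u (Inr p) * (if p = q then a p else 0) * u (Inr q))
        = (\<Sum>q\<in>Q. if p = q then a p * (u (Inr p))\<^sup>2 else 0)"
      by (intro sum.cong) (auto simp: power2_eq_square)
    then show ?thesis using that assms(2) by simp
  qed
  then show ?thesis
    by (simp add: sum.Plus assms block_diagonal_def)
qed

text \<open>Test vectors supported on a single block recover each condition separately; conversely,
  the form is the sum of the forms of the blocks.\<close>

lemma block_diagonal_form_nonneg_iff:
  fixes G :: "'k \<Rightarrow> 'k \<Rightarrow> real" and a :: "'q \<Rightarrow> real"
  assumes "finite K" and "finite Q"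
  shows "(\<forall>u. 0 \<le> (\<Sum>r\<in>K <+> Q. \<Sum>c\<in>K <+> Q. u r * block_diagonal G a r c * u c)) \<longleftrightarrow>
    (\<forall>u. 0 \<le> (\<Sum>r\<in>K. \<Sum>c\<in>K. u r * G r c * u c)) \<and> (\<forall>q\<in>Q. 0 \<le> a q)"
  unfolding block_diagonal_form[OF assms]
proof (intro iffI conjI allI ballI)
  fix u assume *: "\<forall>u. 0 \<le> (\<Sum>r\<in>K. \<Sum>c\<in>K. u (Inl r) * G r c * u (Inl c)) + (\<Sum>q\<in>Q. a q * (u (Inr q))\<^sup>2)"
  show "0 \<le> (\<Sum>r\<in>K. \<Sum>c\<in>K. u r * G r c * u c)"
    using *[rule_format, of "case_sum u (\<lambda>_. 0)"] by simp
next
  fix q assume *: "\<forall>u. 0 \<le> (\<Sum>r\<in>K. \<Sum>c\<in>K. u (Inl r) * G r c * u (Inl c)) + (\<Sum>q\<in>Q. a q * (u (Inr q))\<^sup>2)"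
    and q: "q \<in> Q"
  have "(\<Sum>p\<in>Q. a p * (of_bool (p = q))\<^sup>2) = (\<Sum>p\<in>Q. if p = q then a p else 0)"
    by (intro sum.cong) auto
  then show "0 \<le> a q"
    using *[rule_format, of "case_sum (\<lambda>_. 0) (\<lambda>p. of_bool (p = q))"] q assms(2) by simp
next
  fix u :: "'k + 'q \<Rightarrow> real"
  assume *: "(\<forall>u. 0 \<le> (\<Sum>r\<in>K. \<Sum>c\<in>K. u r * G r c * u c)) \<and> (\<forall>q\<in>Q. 0 \<le> a q)"
  then have "0 \<le> (\<Sum>r\<in>K. \<Sum>c\<in>K. u (Inl r) * G r c * u (Inl c))"
    by (auto dest: spec[of _ "\<lambda>r. u (Inl r)"])
  with * show "0 \<le> (\<Sum>r\<in>K. \<Sum>c\<in>K. u (Inl r) * G r c * u (Inl c)) + (\<Sum>q\<in>Q. a q * (u (Inr q))\<^sup>2)"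
    by (simp add: sum_nonneg)
qed

lemma projected_spectrahedron_LMI_ineqs:
  fixes G\<^sub>0 :: "'k \<Rightarrow> 'k \<Rightarrow> real" and GI :: "'i \<Rightarrow> 'k \<Rightarrow> 'k \<Rightarrow> real" and GJ :: "'j \<Rightarrow> 'k \<Rightarrow> 'k \<Rightarrow> real"
    and a\<^sub>0 :: "'q \<Rightarrow> real" and aI :: "'i \<Rightarrow> 'q \<Rightarrow> real" and aJ :: "'j \<Rightarrow> 'q \<Rightarrow> real"
  assumes "finite I" and "finite J" and "finite K" and "finite Q"
  shows "projected_spectrahedron I {x \<in> I \<rightarrow>\<^sub>E UNIV. \<exists>y.
    (\<forall>u. 0 \<le> (\<Sum>r\<in>K. \<Sum>c\<in>K.
      u r * (G\<^sub>0 r c + (\<Sum>i\<in>I. x i * GI i r c) + (\<Sum>j\<in>J. y j * GJ j r c)) * u c)) \<and>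
    (\<forall>q\<in>Q. 0 \<le> a\<^sub>0 q + (\<Sum>i\<in>I. x i * aI i q) + (\<Sum>j\<in>J. y j * aJ j q))}"
proof -
  \<comment> \<open>\<open>block_diagonal\<close> is jointly linear in its matrix and its scalars,
    so an affine combination of blocks is the block of the affine combinations.\<close>
  have "block_diagonal G\<^sub>0 a\<^sub>0 r c + (\<Sum>i\<in>I. x i * block_diagonal (GI i) (aI i) r c)
      + (\<Sum>j\<in>J. y j * block_diagonal (GJ j) (aJ j) r c)
    = block_diagonal (\<lambda>r c. G\<^sub>0 r c + (\<Sum>i\<in>I. x i * GI i r c) + (\<Sum>j\<in>J. y j * GJ j r c))
        (\<lambda>q. a\<^sub>0 q + (\<Sum>i\<in>I. x i * aI i q) + (\<Sum>j\<in>J. y j * aJ j q)) r c" for x y r c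
    by (auto simp: block_diagonal_def split: sum.split)
  with projected_spectrahedron_LMI[OF assms(1,2), of "K <+> Q" "block_diagonal G\<^sub>0 a\<^sub>0"
      "\<lambda>i. block_diagonal (GI i) (aI i)" "\<lambda>j. block_diagonal (GJ j) (aJ j)"]
  show ?thesis
    using assms by (simp add: block_diagonal_form_nonneg_iff)
qed

text \<open>The entries of \<open>W\<close> become the auxiliary variables. Expanding vectors of
  \<open>span B\<close> in \<open>B\<close> turns the first condition into nonnegativity of a
  quadratic form with coefficients \<open>matrix_form d W v w\<close>, which are linear in
  \<open>W\<close>.\<close>

lemma projected_spectrahedron_multipliers:
  assumes "finite N" and "finite I" and "finite B"
  shows "projected_spectrahedron N {x \<in> N \<rightarrow>\<^sub>E UNIV.
    \<exists>W. (\<forall>v\<in>span B. 0 \<le> matrix_form d W v v) \<and>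
      (\<forall>t\<in>I. trace_inner d W (A t) = l\<^sub>0 t + (\<Sum>i\<in>N. x i * l i t)) \<and> trace_inner d W A\<^sub>0 \<le> c}"
proof -
  let ?J = "{..<d} \<times> {..<d}"
  \<comment> \<open>\<open>None\<close> stands for the bound on the pairing with
    \<open>A\<^sub>0\<close>; \<open>Some (s, t)\<close> with \<open>s\<close> equal to 1 or -1
    gives the two inequalities that make up the equation for \<open>A t\<close>.\<close>
  define Q where "Q = insert None (Some ` ({1, -1 :: real} \<times> I))"
  define GJ :: "nat \<times> nat \<Rightarrow> (nat \<Rightarrow> real) \<Rightarrow> (nat \<Rightarrow> real) \<Rightarrow> real"
    where "GJ = (\<lambda>(r, c) v w. v r * w c)"
  define a\<^sub>0 where "a\<^sub>0 = case_option c (\<lambda>(s, t). - s * l\<^sub>0 t)"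
  define aN where "aN = (\<lambda>i. case_option 0 (\<lambda>(s, t). - s * l i t))"
  define aJ where "aJ = (\<lambda>(r, c). case_option (- A\<^sub>0 r c) (\<lambda>(s, t). s * A t r c))"
  have form: "matrix_form d W v w = (\<Sum>j\<in>?J. case_prod W j * GJ j v w)" for W v w
    by (simp add: matrix_form_def GJ_def sum.cartesian_product case_prod_unfold algebra_simps)
  have trace: "trace_inner d W X = (\<Sum>j\<in>?J. case_prod W j * case_prod X j)" for W X
    by (simp add: trace_inner_def sum.cartesian_product case_prod_unfold)
  have span_iff: "(\<forall>v\<in>span B. 0 \<le> matrix_form d W v v) \<longleftrightarrow>
    (\<forall>u. 0 \<le> (\<Sum>v\<in>B. \<Sum>w\<in>B. u v * matrix_form d W v w * u w))" for W
  proof -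
    have "matrix_form d W (\<Sum>v\<in>B. u v *\<^sub>R v) (\<Sum>v\<in>B. u v *\<^sub>R v)
      = (\<Sum>v\<in>B. \<Sum>w\<in>B. u v * matrix_form d W v w * u w)" for u
      by (simp add: linear_sum[OF linear_matrix_form_left] linear_sum[OF linear_matrix_form_right]
          matrix_form_linear_simps sum_distrib_left, subst sum.swap, simp add: algebra_simps)
    then show ?thesis by (auto simp: span_finite[OF assms(3)])
  qed
  have ineqs: "(\<forall>q\<in>Q. 0 \<le> a\<^sub>0 q + (\<Sum>i\<in>N. x i * aN i q) + (\<Sum>j\<in>?J. case_prod W j * aJ j q)) \<longleftrightarrow>
    (\<forall>t\<in>I. trace_inner d W (A t) = l\<^sub>0 t + (\<Sum>i\<in>N. x i * l i t)) \<and> trace_inner d W A\<^sub>0 \<le> c"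
    for x W
  proof -
    have "a\<^sub>0 None + (\<Sum>i\<in>N. x i * aN i None) + (\<Sum>j\<in>?J. case_prod W j * aJ j None)
        = c - trace_inner d W A\<^sub>0"
      by (simp add: a\<^sub>0_def aN_def aJ_def trace case_prod_unfold sum_negf)
    moreover have "a\<^sub>0 (Some (s, t)) + (\<Sum>i\<in>N. x i * aN i (Some (s, t)))
        + (\<Sum>j\<in>?J. case_prod W j * aJ j (Some (s, t)))
        = s * (trace_inner d W (A t) - (l\<^sub>0 t + (\<Sum>i\<in>N. x i * l i t)))" for s t
      by (simp add: a\<^sub>0_def aN_def aJ_def trace case_prod_unfold sum_negf sum_distrib_left
          algebra_simps)
    ultimately show ?thesis
      unfolding Q_def by (auto simp: ball_Un intro: antisym)
  qed
  have curry: "(\<exists>W. P (case_prod W)) \<longleftrightarrow> (\<exists>y. P y)" for P :: "(nat \<times> nat \<Rightarrow> real) \<Rightarrow> bool"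
    by (metis case_prod_curry)
  have "(\<exists>W. (\<forall>v\<in>span B. 0 \<le> matrix_form d W v v) \<and>
      (\<forall>t\<in>I. trace_inner d W (A t) = l\<^sub>0 t + (\<Sum>i\<in>N. x i * l i t)) \<and> trace_inner d W A\<^sub>0 \<le> c)
    \<longleftrightarrow> (\<exists>y. (\<forall>u. 0 \<le> (\<Sum>v\<in>B. \<Sum>w\<in>B.
          u v * (0 + (\<Sum>i\<in>N. x i * 0) + (\<Sum>j\<in>?J. y j * GJ j v w)) * u w)) \<and>
        (\<forall>q\<in>Q. 0 \<le> a\<^sub>0 q + (\<Sum>i\<in>N. x i * aN i q) + (\<Sum>j\<in>?J. y j * aJ j q)))" for x
    unfolding curry[symmetric] span_iff ineqs by (simp flip: form)
  then show ?thesis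
    using projected_spectrahedron_LMI_ineqs[of N ?J B Q "\<lambda>_ _. 0" "\<lambda>_ _ _. 0" GJ a\<^sub>0 aN aJ] assms
    by (simp add: Q_def)
qed

section \<open>Closed convex hulls of polynomial images\<close>

lemma mpoly_eval_superset:
  assumes "finite K" and "Poly_Mapping.keys p \<subseteq> K"
  shows "mpoly_eval p x =
    (\<Sum>a\<in>K. Poly_Mapping.lookup p a * (\<Prod>i\<in>UNIV. (x $ i) ^ Poly_Mapping.lookup a i))"
  unfolding mpoly_eval_def using assms
  by (intro sum.mono_neutral_left) (auto simp: in_keys_iff)

lemma linear_mpoly_eval: "linear (\<lambda>p. mpoly_eval p x)"
proof (rule linearI)
  fix p q :: "'a real_mpoly"
  let ?K = "Poly_Mapping.keys p \<union> Poly_Mapping.keys q"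
  have "Poly_Mapping.keys (p + q) \<subseteq> ?K" by (rule Poly_Mapping.keys_add)
  then show "mpoly_eval (p + q) x = mpoly_eval p x + mpoly_eval q x"
    using mpoly_eval_superset[of ?K "p + q"] mpoly_eval_superset[of ?K p]
      mpoly_eval_superset[of ?K q]
    by (simp add: lookup_add algebra_simps sum.distrib)
next
  fix c :: real and p :: "'a real_mpoly"
  have "Poly_Mapping.keys (c *\<^sub>R p) \<subseteq> Poly_Mapping.keys p"
    by (auto simp: in_keys_iff scaleR_poly_mapping.rep_eq)
  then show "mpoly_eval (c *\<^sub>R p) x = c *\<^sub>R mpoly_eval p x"
    using mpoly_eval_superset[of "Poly_Mapping.keys p" "c *\<^sub>R p"]
    by (simp add: mpoly_eval_def scaleR_poly_mapping.rep_eq sum_distrib_left mult.assoc)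
qed

lemma mpoly_eval_1 [simp]: "mpoly_eval 1 x = 1"
  by (simp add: mpoly_eval_def)

text \<open>Halfspaces are closed and convex, and a point outside a closed convex set is strictly
  separated from it. Allowing \<open>a = 0\<close> makes the equivalence correct for empty
  \<open>X\<close> too.\<close>

lemma closure_convex_hull_iff_halfspaces:
  fixes X :: "'a::euclidean_space set"
  shows "x \<in> closure (convex hull X) \<longleftrightarrow>
    (\<forall>c a. (\<forall>y\<in>X. 0 \<le> c + a \<bullet> y) \<longrightarrow> 0 \<le> c + a \<bullet> x)" (is "?L \<longleftrightarrow> ?R")
proof
  assume ?L
  show ?R
  proof (intro allI impI)
    fix c a assume "\<forall>y\<in>X. 0 \<le> c + a \<bullet> y"
    then have "X \<subseteq> {y. - c \<le> a \<bullet> y}" by auto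
    then have "closure (convex hull X) \<subseteq> {y. - c \<le> a \<bullet> y}"
      by (intro closure_minimal hull_minimal)
         (simp_all add: closed_halfspace_ge convex_halfspace_ge)
    with \<open>?L\<close> show "0 \<le> c + a \<bullet> x" by auto
  qed
next
  assume R: ?R
  show ?L
  proof (rule ccontr)
    assume "\<not> ?L"
    then obtain a b where ab: "a \<bullet> x < b" "\<forall>y\<in>closure (convex hull X). b < a \<bullet> y"
      using separating_hyperplane_closed_point[of "closure (convex hull X)" x] by auto
    have "X \<subseteq> closure (convex hull X)"
      using hull_subset closure_subset by (rule subset_trans)
    with ab(2) have "\<forall>y\<in>X. 0 \<le> - b + a \<bullet> y" by force
    with R have "0 \<le> - b + a \<bullet> x" by blast
    with ab(1) show False by simp
  qed
qed

lemma sum_UNIV_option: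
  fixes g :: "'a::finite option \<Rightarrow> 'b::comm_monoid_add"
  shows "(\<Sum>k\<in>UNIV. g k) = g None + (\<Sum>i\<in>UNIV. g (Some i))"
  by (simp add: UNIV_option_conv sum.reindex)

text \<open>Affine functionals are written homogeneously: index \<open>None\<close> carries the
  constant term, paired with the polynomial 1. The pullback along the map is then a linear
  combination of 1 and the \<open>f i\<close>.\<close>

lemma closure_convex_hull_moments:
  fixes f :: "'m::finite \<Rightarrow> 'n::finite real_mpoly"
  shows "x \<in> closure (convex hull ((\<lambda>s. \<chi> i. mpoly_eval (f i) s) ` S)) \<longleftrightarrow>
    (\<forall>a. (\<forall>s\<in>S. 0 \<le> mpoly_eval (\<Sum>k\<in>UNIV. a k *\<^sub>R case_option 1 f k) s) \<longrightarrow>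
      0 \<le> (\<Sum>k\<in>UNIV. a k * case_option 1 (($) x) k))" (is "_ \<longleftrightarrow> ?R")
proof -
  have eval: "mpoly_eval (\<Sum>k\<in>UNIV. a k *\<^sub>R case_option 1 f k) s
      = a None + (\<chi> i. a (Some i)) \<bullet> (\<chi> i. mpoly_eval (f i) s)" for a s
    by (simp add: sum_UNIV_option linear_add[OF linear_mpoly_eval] linear_sum[OF linear_mpoly_eval]
        linear_scale[OF linear_mpoly_eval] inner_vec_def)
  have val: "(\<Sum>k\<in>UNIV. a k * case_option 1 (($) x) k) = a None + (\<chi> i. a (Some i)) \<bullet> x" for a
    by (simp add: sum_UNIV_option inner_vec_def)
  have "?R \<longleftrightarrow> (\<forall>c b. (\<forall>s\<in>S. 0 \<le> c + b \<bullet> (\<chi> i. mpoly_eval (f i) s)) \<longrightarrow> 0 \<le> c + b \<bullet> x)"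
    unfolding eval val
  proof (intro iffI allI)
    fix c and b :: "real ^ 'm"
    assume "\<forall>a. (\<forall>s\<in>S. 0 \<le> a None + (\<chi> i. a (Some i)) \<bullet> (\<chi> i. mpoly_eval (f i) s)) \<longrightarrow>
      0 \<le> a None + (\<chi> i. a (Some i)) \<bullet> x"
    from this[rule_format, of "case_option c (($) b)"]
    show "(\<forall>s\<in>S. 0 \<le> c + b \<bullet> (\<chi> i. mpoly_eval (f i) s)) \<longrightarrow> 0 \<le> c + b \<bullet> x" by simp
  qed blast
  then show ?thesis by (simp add: closure_convex_hull_iff_halfspaces)
qed

text \<open>The elements \<open>F k\<close> need not be linearly independent: the pencil is pulled back along the
  linear map sending \<open>a\<close> to \<open>\<Sum>k. a k *\<^sub>R F k\<close>.\<close>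

lemma projected_spectrahedron_in_pullback:
  fixes F :: "'k::finite \<Rightarrow> 'v::real_vector"
  assumes "projected_spectrahedron_in V P" and F: "\<And>k. F k \<in> V"
  shows "\<exists>d A\<^sub>0 A (M::nat). \<forall>a. (\<Sum>k\<in>UNIV. a k *\<^sub>R F k) \<in> P \<longleftrightarrow>
    (\<exists>y. psd_matrix d (pencil A\<^sub>0 A (UNIV <+> {..<M}) 1 (case_sum a y)))"
proof -
  obtain B where B: "finite B" "independent B" "span B = V"
    and "projected_spectrahedron B {z \<in> B \<rightarrow>\<^sub>E UNIV. (\<Sum>b\<in>B. z b *\<^sub>R b) \<in> P}"
    using assms(1) unfolding projected_spectrahedron_in_def by blast
  then obtain M T where T: "spectrahedron (B <+> {..<M::nat}) T"
    and P: "{z \<in> B \<rightarrow>\<^sub>E UNIV. (\<Sum>b\<in>B. z b *\<^sub>R b) \<in> P}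
      = {z \<in> B \<rightarrow>\<^sub>E UNIV. \<exists>y\<in>{..<M} \<rightarrow>\<^sub>E UNIV. case_sum z y \<in> T}"
    unfolding projected_spectrahedron_def by blast
  obtain d A\<^sub>0 A where T_eq: "T = {z \<in> (B <+> {..<M}) \<rightarrow>\<^sub>E UNIV.
      psd_matrix d (\<lambda>r c. A\<^sub>0 r c + (\<Sum>t\<in>B <+> {..<M}. z t * A t r c))}"
    using T unfolding spectrahedron_def by blast
  define rep where "rep = (\<lambda>k. representation B (F k))"
  \<comment> \<open>Substitutes the coordinates of the combination of the \<open>F k\<close> with
    respect to \<open>B\<close> into the given pencil, regrouped by the coefficients
    \<open>a k\<close>.\<close>
  define A' where "A' = case_sum (\<lambda>k. \<Sum>b\<in>B. rep k b *\<^sub>R A (Inl b)) (\<lambda>j. A (Inr j))"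
  have F_rep: "F k = (\<Sum>b\<in>B. rep k b *\<^sub>R b)" for k
    using sum_representation_eq[OF B(2) _ B(1) subset_refl, of "F k"] F B(3)
    by (simp add: rep_def)
  have "(\<Sum>k\<in>UNIV. a k *\<^sub>R F k) \<in> P \<longleftrightarrow>
    (\<exists>y. psd_matrix d (pencil A\<^sub>0 A' (UNIV <+> {..<M}) 1 (case_sum a y)))" for a
  proof -
    define z where "z = restrict (\<lambda>b. \<Sum>k\<in>UNIV. a k * rep k b) B"
    have z: "z \<in> B \<rightarrow>\<^sub>E UNIV" by (simp add: z_def)
    have "(\<Sum>k\<in>UNIV. a k *\<^sub>R F k) = (\<Sum>k\<in>UNIV. \<Sum>b\<in>B. (a k * rep k b) *\<^sub>R b)"
      by (simp add: F_rep scaleR_sum_right)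
    also have "\<dots> = (\<Sum>b\<in>B. z b *\<^sub>R b)"
      by (subst sum.swap) (simp add: z_def scaleR_sum_left)
    finally have mem: "(\<Sum>k\<in>UNIV. a k *\<^sub>R F k) \<in> P \<longleftrightarrow> (\<exists>y\<in>{..<M} \<rightarrow>\<^sub>E UNIV. case_sum z y \<in> T)"
      using arg_cong[OF P, of "\<lambda>X. z \<in> X"] z by simp
    have T_iff: "case_sum z y \<in> T \<longleftrightarrow>
        psd_matrix d (pencil A\<^sub>0 A' (UNIV <+> {..<M}) 1 (case_sum a y))"
      if y: "y \<in> {..<M} \<rightarrow>\<^sub>E UNIV" for y
    proof -
      have "case_sum z y \<in> (B <+> {..<M}) \<rightarrow>\<^sub>E UNIV"
        using z y by (auto simp: PiE_iff extensional_def split: sum.split)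
      moreover have "(\<Sum>b\<in>B. z b * A (Inl b) r c)
          = (\<Sum>k\<in>UNIV. a k * (\<Sum>b\<in>B. rep k b * A (Inl b) r c))" for r c
        by (simp add: z_def sum_distrib_left sum_distrib_right, subst sum.swap)
           (simp add: mult.assoc)
      then have "(\<lambda>r c. A\<^sub>0 r c + (\<Sum>t\<in>B <+> {..<M}. case_sum z y t * A t r c))
          = pencil A\<^sub>0 A' (UNIV <+> {..<M}) 1 (case_sum a y)"
        by (simp add: fun_eq_iff pencil_def sum.Plus B(1) A'_def)
      ultimately show ?thesis by (simp add: T_eq)
    qed
    have restrict: "pencil A\<^sub>0 A' (UNIV <+> {..<M}) 1 (case_sum a (restrict y {..<M}))
        = pencil A\<^sub>0 A' (UNIV <+> {..<M}) 1 (case_sum a y)" for y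
      by (simp add: pencil_def sum.Plus)
    have "\<exists>y\<in>{..<M} \<rightarrow>\<^sub>E UNIV. case_sum z y \<in> T"
      if "psd_matrix d (pencil A\<^sub>0 A' (UNIV <+> {..<M}) 1 (case_sum a y))" for y
      by (rule bexI[of _ "restrict y {..<M}"]) (simp_all add: T_iff restrict that)
    then show ?thesis unfolding mem using T_iff by blast
  qed
  then show ?thesis by (intro exI allI)
qed

theorem proposition3p10:
  fixes S :: "(real ^ 'n::finite) set"
    and V :: "'n real_mpoly set"
    and f :: "'m::finite \<Rightarrow> 'n real_mpoly"
  assumes "subspace V"
    and "\<exists>B. finite B \<and> span B = V"
    and "1 \<in> V"
    and "projected_spectrahedron_in V {p \<in> V. \<forall>x\<in>S. mpoly_eval p x \<ge> 0}"
    and "\<And>i. f i \<in> V"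
  shows "projected_spectrahedron_vec
           (closure (convex hull ((\<lambda>x. \<chi> i. mpoly_eval (f i) x) ` S)) :: (real ^ 'm) set)"
proof -
  let ?F = "case_option 1 f"
  have F: "?F k \<in> V" for k using assms(3,5) by (cases k) auto
  obtain d A\<^sub>0 A and M :: nat
    where pullback: "\<forall>a. (\<Sum>k\<in>UNIV. a k *\<^sub>R ?F k) \<in> {p \<in> V. \<forall>x\<in>S. mpoly_eval p x \<ge> 0} \<longleftrightarrow>
      (\<exists>y. psd_matrix d (pencil A\<^sub>0 A (UNIV <+> {..<M}) 1 (case_sum a y)))"
    using projected_spectrahedron_in_pullback[OF assms(4), of ?F, OF F] by (elim exE)
  let ?I = "UNIV <+> {..<M} :: ('m option + nat) set"
  let ?L = "pencil A\<^sub>0 A ?I 1"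
  have sum_V: "(\<Sum>k\<in>UNIV. a k *\<^sub>R ?F k) \<in> V" for a
    using F by (intro subspace_sum[OF assms(1)] subspace_scale[OF assms(1)])
  \<comment> \<open>The zero polynomial is nonnegative on \<open>S\<close>, so \<open>a = 0\<close>
    lifts to a point of the spectrahedron; the duality theorem requires one.\<close>
  have "\<exists>y. psd_matrix d (?L (case_sum (\<lambda>_. 0) y))"
    unfolding pullback[rule_format, symmetric]
    using subspace_0[OF assms(1)] by (simp add: linear_0[OF linear_mpoly_eval])
  then obtain z\<^sub>0 where z0: "psd_matrix d (?L z\<^sub>0)" by blast
  obtain B where B: "finite B" and dual: "\<forall>l c.
      (\<forall>z. psd_matrix d (?L z) \<longrightarrow> 0 \<le> c + (\<Sum>t\<in>?I. l t * z t)) \<longleftrightarrow>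
      (\<exists>W. (\<forall>v\<in>span B. 0 \<le> matrix_form d W v v) \<and>
         (\<forall>t\<in>?I. trace_inner d W (A t) = l t) \<and> trace_inner d W A\<^sub>0 \<le> c)"
    using spectrahedron_dual[OF _ z0] by auto
  \<comment> \<open>The functional attached to \<open>x\<close> has coefficient 1 at
    \<open>None\<close>, \<open>x $ i\<close> at \<open>Some i\<close> and 0 at the auxiliary
    coordinates. Written with \<open>l\<^sub>0\<close> and \<open>l\<close> it is visibly affine in
    \<open>x\<close>.\<close>
  define l\<^sub>0 :: "'m option + nat \<Rightarrow> real" where "l\<^sub>0 t = of_bool (t = Inl None)" for t
  define l :: "'m \<Rightarrow> 'm option + nat \<Rightarrow> real" where "l i t = of_bool (t = Inl (Some i))" for i t
  have C_iff: "x \<in> closure (convex hull ((\<lambda>x. \<chi> i. mpoly_eval (f i) x) ` S)) \<longleftrightarrow>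
      (\<exists>W. (\<forall>v\<in>span B. 0 \<le> matrix_form d W v v) \<and>
         (\<forall>t\<in>?I. trace_inner d W (A t) = l\<^sub>0 t + (\<Sum>i\<in>UNIV. x $ i * l i t)) \<and>
         trace_inner d W A\<^sub>0 \<le> 0)" for x
  proof -
    have l_eq: "l\<^sub>0 t + (\<Sum>i\<in>UNIV. x $ i * l i t)
        = case_sum (case_option 1 (($) x)) (\<lambda>_. 0) t" for t
    proof -
      have "(\<Sum>i\<in>UNIV. x $ i * of_bool (j = i)) = (\<Sum>i\<in>UNIV. if j = i then x $ i else 0)" for j
        by (intro sum.cong) auto
      then show ?thesis by (auto simp: l\<^sub>0_def l_def split: sum.split option.split)
    qed
    have sum_eq: "(\<Sum>t\<in>?I. case_sum (case_option 1 (($) x)) (\<lambda>_. 0) t * case_sum a y t)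
        = (\<Sum>k\<in>UNIV. a k * case_option 1 (($) x) k)" for a y
      by (simp add: sum.Plus mult.commute)
    have split: "(\<forall>z. Q z) \<longleftrightarrow> (\<forall>a y. Q (case_sum a y))" for Q :: "('m option + nat \<Rightarrow> real) \<Rightarrow> bool"
      using surjective_sum[symmetric] by metis
    \<comment> \<open>The functional ignores the auxiliary coordinates, so its nonnegativity on the
      spectrahedron is nonnegativity on the projection to the coordinates \<open>a\<close>.\<close>
    have "(\<forall>z. psd_matrix d (?L z) \<longrightarrow>
          0 \<le> 0 + (\<Sum>t\<in>?I. case_sum (case_option 1 (($) x)) (\<lambda>_. 0) t * z t)) \<longleftrightarrow>
        (\<forall>a. (\<exists>y. psd_matrix d (?L (case_sum a y))) \<longrightarrow>
          0 \<le> (\<Sum>k\<in>UNIV. a k * case_option 1 (($) x) k))"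
      unfolding split sum_eq by auto
    then show ?thesis
      unfolding dual[rule_format] l_eq closure_convex_hull_moments pullback[rule_format, symmetric]
      using sum_V by simp
  qed
  have "($) ` closure (convex hull ((\<lambda>x. \<chi> i. mpoly_eval (f i) x) ` S)) =
    {x \<in> UNIV \<rightarrow>\<^sub>E UNIV. \<exists>W. (\<forall>v\<in>span B. 0 \<le> matrix_form d W v v) \<and>
         (\<forall>t\<in>?I. trace_inner d W (A t) = l\<^sub>0 t + (\<Sum>i\<in>UNIV. x i * l i t)) \<and>
         trace_inner d W A\<^sub>0 \<le> 0}" (is "_ ` ?C = ?D")
  proof (rule set_eqI)
    fix x :: "'m \<Rightarrow> real"
    have "x \<in> ($) ` ?C \<longleftrightarrow> (\<chi> i. x i) \<in> ?C"
      by (force simp: image_iff intro: bexI[of _ "\<chi> i. x i"])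
    then show "x \<in> ($) ` ?C \<longleftrightarrow> x \<in> ?D" by (simp add: C_iff)
  qed
  then show ?thesis
    unfolding projected_spectrahedron_vec_def
    using projected_spectrahedron_multipliers[of UNIV ?I B d A l\<^sub>0 l A\<^sub>0 0] B by simp
qed

end
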